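(* Let $K$ be a field, let $G$ be a closed graph on the vertex set $[n]=\{1,\ldots,n\}$, and let $J_G\subset S=K[x_1,\ldots,x_n,y_1,\ldots,y_n]$ be its binomial edge ideal. Then $J_G^{(k)}=J_G^k$ for all integers $k\geq 1$.
   Context: All graphs are simple. The binomial edge ideal of a graph $G$ on $[n]$ with edge set $E(G)$ is $J_G=(x_iy_j-x_jy_i : i<j,\ \{i,j\}\in E(G))\subset S$. The graph $G$ is called closed if there exists a labeling of its vertices (by $1,\ldots,n$) such that for any edge $\{i,k\}$ with $i<k$ and for every $j$ with $i<j<k$, one has $\{i,j\}\in E(G)$ and $\{j,k\}\in E(G)$. For an ideal $I$ in a Noetherian ring $R$ with set of minimal primes $\operatorname{Min}(I)$ and $k\ge 1$, the $k$-th symbolic power of $I$ is $I^{(k)}=\bigcap_{\mathfrak p\in\operatorname{Min}(I)}(I^kR_{\mathfrak p}\cap R)$, equivalently $I^{(k)}=\{a\in R:\text{ there exists } w\notin\bigcup_{\mathfrak p\in\operatorname{Min}(I)}\mathfrak p \text{ with } wa\in I^k\}$. *)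

theory Defs
  imports "HOL-Algebra.Algebra" "HOL-Library.Poly_Mapping"
begin

section \<open>Closed graphs\<close>

text \<open>A simple graph on \<open>{1..n}\<close> is given by its set of edges, each edge being a two-element set.\<close>

definition simple_graph :: "nat \<Rightarrow> nat set set \<Rightarrow> bool" where
  "simple_graph n E \<longleftrightarrow> (\<forall>e\<in>E. e \<subseteq> {1..n} \<and> card e = 2)"

text \<open>The labeling \<open>l\<close> need not be the labeling that is used to define the binomial edge ideal.\<close>

definition closed_graph :: "nat \<Rightarrow> nat set set \<Rightarrow> bool" where
  "closed_graph n E \<longleftrightarrow>
     (\<exists>l. bij_betw l {1..n} {1..n} \<and>
       (\<forall>u\<in>{1..n}. \<forall>v\<in>{1..n}. \<forall>w\<in>{1..n}.
          {u, w} \<in> E \<and> l u < l v \<and> l v < l w \<longrightarrow> {u, v} \<in> E \<and> {v, w} \<in> E))"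

section \<open>Polynomial rings\<close>

datatype indet = XVar nat | YVar nat

text \<open>A monomial is a finitely supported exponent vector \<open>indet \<Rightarrow>\<^sub>0 nat\<close>; a polynomial is a
  finitely supported function from monomials to coefficients, with convolution as product.\<close>

type_synonym 'k mpoly = "(indet \<Rightarrow>\<^sub>0 nat) \<Rightarrow>\<^sub>0 'k"

definition variables :: "nat \<Rightarrow> indet set" where
  "variables n = XVar ` {1..n} \<union> YVar ` {1..n}"

text \<open>The type \<open>'k mpoly\<close> has infinitely many variables. The ring
  \<open>K[x\<^sub>1,\<dots>,x\<^sub>n,y\<^sub>1,\<dots>,y\<^sub>n]\<close> is the subring of the polynomials involving only \<open>variables n\<close>.\<close>

definition polynomial_ring :: "nat \<Rightarrow> ('k::field) mpoly ring" where
  "polynomial_ring n =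
     \<lparr>carrier = {p. \<forall>m\<in>Poly_Mapping.keys p. Poly_Mapping.keys m \<subseteq> variables n},
      monoid.mult = (*), one = 1, ring.zero = 0, add = (+)\<rparr>"

definition var_poly :: "indet \<Rightarrow> ('k::field) mpoly" where
  "var_poly v = Poly_Mapping.single (Poly_Mapping.single v 1) 1"

section \<open>Binomial edge ideals\<close>

definition edge_binomial :: "nat \<Rightarrow> nat \<Rightarrow> ('k::field) mpoly" where
  "edge_binomial i j =
     var_poly (XVar i) * var_poly (YVar j) - var_poly (XVar j) * var_poly (YVar i)"

definition binomial_edge_ideal :: "nat \<Rightarrow> nat set set \<Rightarrow> ('k::field) mpoly set" where
  "binomial_edge_ideal n E =
     Idl\<^bsub>polynomial_ring n\<^esub> {edge_binomial i j | i j. i < j \<and> {i, j} \<in> E}"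

section \<open>Ordinary and symbolic powers of ideals\<close>

abbreviation ideal_power :: "('a, 'b) ring_scheme \<Rightarrow> 'a set \<Rightarrow> nat \<Rightarrow> 'a set" where
  "ideal_power R I k \<equiv> I [^]\<^bsub>ideals_set R\<^esub> k"

definition minimal_primes :: "('a, 'b) ring_scheme \<Rightarrow> 'a set \<Rightarrow> 'a set set" where
  "minimal_primes R I =
     {P. primeideal P R \<and> I \<subseteq> P \<and> (\<forall>Q. primeideal Q R \<and> I \<subseteq> Q \<and> Q \<subseteq> P \<longrightarrow> Q = P)}"

text \<open>For a Noetherian ring \<open>R\<close> this is the intersection, over the minimal primes \<open>P\<close> of \<open>I\<close>, of the
  contractions to \<open>R\<close> of the extensions of \<open>I\<^sup>k\<close> to the localizations \<open>R\<^sub>P\<close>.\<close>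

definition symbolic_power :: "('a, 'b) ring_scheme \<Rightarrow> 'a set \<Rightarrow> nat \<Rightarrow> 'a set" where
  "symbolic_power R I k =
     {a \<in> carrier R. \<exists>w \<in> carrier R. w \<notin> \<Union>(minimal_primes R I) \<and> w \<otimes>\<^bsub>R\<^esub> a \<in> ideal_power R I k}"

section \<open>Well-formedness\<close>

lemma cring_polynomial_ring: "cring (polynomial_ring n :: ('k::field) mpoly ring)"
proof -
  let ?R = "polynomial_ring n :: 'k mpoly ring"
  have add: "p + q \<in> carrier ?R" if "p \<in> carrier ?R" "q \<in> carrier ?R" for p q
    using that Poly_Mapping.keys_add[of p q] unfolding polynomial_ring_def by fastforce
  have mult: "p * q \<in> carrier ?R" if "p \<in> carrier ?R" "q \<in> carrier ?R" for p q
  proof -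
    have "Poly_Mapping.keys m \<subseteq> variables n" if "m \<in> Poly_Mapping.keys (p * q)" for m
    proof -
      obtain a b where "m = a + b" "a \<in> Poly_Mapping.keys p" "b \<in> Poly_Mapping.keys q"
        using \<open>m \<in> Poly_Mapping.keys (p * q)\<close> keys_mult[of p q] by blast
      moreover from this have
        "Poly_Mapping.keys a \<subseteq> variables n" "Poly_Mapping.keys b \<subseteq> variables n"
        using \<open>p \<in> carrier ?R\<close> \<open>q \<in> carrier ?R\<close> by (auto simp: polynomial_ring_def)
      ultimately show ?thesis
        using Poly_Mapping.keys_add[of a b] by blast
    qed
    then show ?thesis by (simp add: polynomial_ring_def)
  qed
  have uminus: "- p \<in> carrier ?R" if "p \<in> carrier ?R" for p
    using that by (auto simp: polynomial_ring_def in_keys_iff)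
  have one: "1 \<in> carrier ?R" and zero: "0 \<in> carrier ?R"
    by (auto simp: polynomial_ring_def)
  have ops: "x \<oplus>\<^bsub>?R\<^esub> y = x + y" "x \<otimes>\<^bsub>?R\<^esub> y = x * y" "\<one>\<^bsub>?R\<^esub> = 1" "\<zero>\<^bsub>?R\<^esub> = 0" for x y
    by (simp_all add: polynomial_ring_def)
  show ?thesis
  proof (rule cringI)
    show "abelian_group ?R"
    proof (rule abelian_groupI, unfold ops)
      show "\<exists>y\<in>carrier ?R. y + x = 0" if "x \<in> carrier ?R" for x
        using uminus[OF that] by (rule bexI[rotated]) simp
    qed (simp_all add: add zero ac_simps)
    show "Group.comm_monoid ?R"
      by (rule comm_monoidI; unfold ops) (simp_all add: mult one ac_simps)
    show "(x \<oplus>\<^bsub>?R\<^esub> y) \<otimes>\<^bsub>?R\<^esub> z = x \<otimes>\<^bsub>?R\<^esub> z \<oplus>\<^bsub>?R\<^esub> y \<otimes>\<^bsub>?R\<^esub> z" for x y z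
      unfolding ops by (rule distrib_right)
  qed
qed

lemma edge_binomial_closed:
  assumes "i \<in> {1..n}" "j \<in> {1..n}"
  shows "(edge_binomial i j :: ('k::field) mpoly) \<in> carrier (polynomial_ring n)"
proof -
  let ?M = "\<lambda>a b. Poly_Mapping.single (XVar a) 1 + Poly_Mapping.single (YVar b) (1::nat)"
  have keys_M: "Poly_Mapping.keys (?M a b) \<subseteq> variables n" if "a \<in> {1..n}" "b \<in> {1..n}" for a b
    using that Poly_Mapping.keys_add[of "Poly_Mapping.single (XVar a) 1" "Poly_Mapping.single (YVar b) (1::nat)"]
    by (auto simp: variables_def)
  have eq: "edge_binomial i j =
      Poly_Mapping.single (?M i j) (1::'k::field) - Poly_Mapping.single (?M j i) 1"
    by (simp add: edge_binomial_def var_poly_def mult_single)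
  have "Poly_Mapping.keys (edge_binomial i j :: 'k::field mpoly) \<subseteq> {?M i j, ?M j i}"
    unfolding eq using keys_diff[of "Poly_Mapping.single (?M i j) (1::'k)"] by fastforce
  then show ?thesis
    using keys_M[OF assms] keys_M[OF assms(2,1)] by (auto simp: polynomial_ring_def)
qed

lemma ideal_binomial_edge_ideal:
  assumes "simple_graph n E"
  shows "ideal (binomial_edge_ideal n E :: ('k::field) mpoly set) (polynomial_ring n)"
proof -
  interpret cring "polynomial_ring n :: 'k mpoly ring"
    by (rule cring_polynomial_ring)
  show ?thesis
    unfolding binomial_edge_ideal_def
    by (rule genideal_ideal)
      (use assms in \<open>auto simp: simple_graph_def dest!: bspec intro!: edge_binomial_closed\<close>)
qed

end

theory Submission
  imports Defs "HOL-Computational_Algebra.Polynomial"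
begin

text \<open>Weight the indeterminates such that \<open>x\<^sub>i y\<^sub>j\<close> is the leading term of the binomial of the edge
  \<open>{i, j}\<close> if \<open>i\<close> has the smaller label. The products \<open>x\<^sub>i y\<^sub>j\<close> are the edges of a bipartite graph, and
  every minimal vertex cover \<open>C\<close> of that graph gives rise to a minimal prime \<open>P\<close> of the binomial edge
  ideal \<open>J\<close> whose order valuation \<open>v\<close> can be computed from a parametrization of the variety of \<open>P\<close> and
  of generic directions for the members of \<open>C\<close>. In these coordinates the leading terms survive,
  hence \<open>v(f) \<ge> k\<close> forces the leading monomials of \<open>f\<close> to have degree at least \<open>k\<close> in \<open>C\<close>. An
  element \<open>f\<close> of the symbolic power satisfies \<open>v(f) \<ge> k\<close> because \<open>w f \<in> J\<^sup>k\<close> with \<open>v(w) = 0\<close>. By the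
  weighted form of Koenig's theorem, its leading monomials are then divisible by products of \<open>k\<close>
  edges, so that subtracting multiples of products of \<open>k\<close> edge binomials lowers the weight of \<open>f\<close>.\<close>

section \<open>Weighted vertex covers of bipartite graphs\<close>

text \<open>Minimal covers are primes of the monomial ideal generated by the products
  \<open>x_i y_j\<close>, not of \<open>J\<close> itself, and several covers may share one prime of
  \<open>J\<close>: for a complete graph labelled by the identity, the covers by the
  \<open>x_i\<close> with \<open>i < s\<close> and the \<open>y_j\<close> with \<open>j > s\<close>
  all belong to the prime \<open>J\<close>. They differ in the pivot \<open>s\<close>, hence in the
  coordinates and weights used to bound leading monomials. It suffices that every cover yields some
  minimal prime; no primary decomposition of \<open>J\<close> is needed. The weight,
  \<open>n - l i\<close> for \<open>x_i\<close> and 0 for \<open>y_i\<close>, separates the two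
  terms of each edge binomial but is not a monomial order. Ties are harmless because all monomials
  of top weight are cancelled together, so Groebner bases do not enter. Closedness is needed for one
  fact: adjacent vertices outside the cut set have the same pivot. Hence the binomials of edges
  vanish on the parametrized variety.\<close>

definition bip_cover :: "('a \<times> 'b) set \<Rightarrow> 'a set \<Rightarrow> 'b set \<Rightarrow> bool" where
  "bip_cover R A B \<longleftrightarrow> (\<forall>x\<in>A. \<exists>y. (x, y) \<in> R) \<and> (\<forall>y\<in>B. \<exists>x. (x, y) \<in> R) \<and>
     (\<forall>x y. (x, y) \<in> R \<longrightarrow> x \<in> A \<or> y \<in> B)"

text \<open>Members of a cover are required to have a neighbour, so each side lies in a projection
  of \<open>R\<close>; sums of weights over covers are then finite even over infinite types.\<close>

lemma finite_bip_cover: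
  assumes "bip_cover R A B" "finite R"
  shows "finite A" "finite B"
proof -
  have "A \<subseteq> fst ` R" "B \<subseteq> snd ` R"
    using assms(1) unfolding bip_cover_def by force+
  with assms(2) show "finite A" "finite B"
    by (meson finite_imageI finite_subset)+
qed

text \<open>Two passes suffice. Once the left side is pruned against \<open>B0\<close>, pruning the
  right side cannot make a left member redundant: its neighbour outside \<open>B0\<close> stays
  outside the smaller right side.\<close>

lemma bip_cover_subset:
  assumes "bip_cover R A0 B0"
  obtains A B where "bip_cover R A B" "A \<subseteq> A0" "B \<subseteq> B0"
    "\<And>x. x \<in> A \<Longrightarrow> \<exists>y. (x, y) \<in> R \<and> y \<notin> B" "\<And>y. y \<in> B \<Longrightarrow> \<exists>x. (x, y) \<in> R \<and> x \<notin> A"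
proof
  let ?A = "{x \<in> A0. \<exists>y. (x, y) \<in> R \<and> y \<notin> B0}"
  let ?B = "{y \<in> B0. \<exists>x. (x, y) \<in> R \<and> x \<notin> ?A}"
  show "bip_cover R ?A ?B"
    using assms unfolding bip_cover_def by fast
qed auto

text \<open>Meet and join in the lattice of covers, the right sides being ordered by reverse
  inclusion. Meet and join together weigh as much as the two given covers, so minimal weight is
  inherited by both.\<close>

lemma bip_cover_Int_Un:
  assumes "bip_cover R A B" "bip_cover R A' B'"
  shows "bip_cover R (A \<inter> A') (B \<union> B')" "bip_cover R (A \<union> A') (B \<inter> B')"
  using assms unfolding bip_cover_def by fast+

lemma sum_fun_upd_diff1:
  fixes c :: "'a \<Rightarrow> nat"
  assumes "finite A" "c x > 0"
  shows "sum (c(x := c x - 1)) A + (if x \<in> A then 1 else 0) = sum c A"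
proof -
  have "sum c A = (\<Sum>a\<in>A. (c(x := c x - 1)) a + (if a = x then 1 else 0))"
    using assms(2) by (intro sum.cong) auto
  also have "\<dots> = sum (c(x := c x - 1)) A + (if x \<in> A then 1 else 0)"
    using assms(1) by (simp add: sum.distrib)
  finally show ?thesis by simp
qed

text \<open>The induction step of the weighted form of Koenig's theorem. Take a cover of minimal weight whose
  left side has positive weight and is as small as possible, an \<open>x\<close> on its left side, and a neighbour
  \<open>y\<close> outside it. By the lattice property no cover of minimal weight contains both \<open>x\<close> and \<open>y\<close>.\<close>

lemma bip_cover_reduce:
  fixes c :: "'a \<Rightarrow> nat" and d :: "'b \<Rightarrow> nat"
  assumes "finite R"
    and wt: "\<And>A B. bip_cover R A B \<Longrightarrow> Suc k \<le> sum c A + sum d B"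
  obtains x y where "(x, y) \<in> R" "c x > 0" "d y > 0"
    "\<And>A B. bip_cover R A B \<Longrightarrow> k \<le> sum (c(x := c x - 1)) A + sum (d(y := d y - 1)) B"
proof -
  define tight where "tight A B \<longleftrightarrow> bip_cover R A B \<and> sum c A + sum d B = Suc k" for A B
  have fin: "finite A" "finite B" if "bip_cover R A B" for A B
    using finite_bip_cover[OF that \<open>finite R\<close>] by simp_all
  have lattice: "tight (A \<inter> A') (B \<union> B')" if "tight A B" "tight A' B'" for A B A' B'
  proof -
    have cov: "bip_cover R A B" "bip_cover R A' B'"
      using that by (auto simp: tight_def)
    have "sum c (A \<union> A') + sum c (A \<inter> A') = sum c A + sum c A'"
      "sum d (B \<union> B') + sum d (B \<inter> B') = sum d B + sum d B'"
      using fin[OF cov(1)] fin[OF cov(2)] by (simp_all add: sum.union_inter)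
    with wt[OF bip_cover_Int_Un(1)[OF cov]] wt[OF bip_cover_Int_Un(2)[OF cov]] that
    show ?thesis
      using bip_cover_Int_Un(1)[OF cov] by (auto simp: tight_def)
  qed
  have "\<exists>x y. (x, y) \<in> R \<and> c x > 0 \<and> d y > 0 \<and> (\<forall>A B. tight A B \<longrightarrow> \<not> (x \<in> A \<and> y \<in> B))"
  proof (cases "\<exists>A B. tight A B \<and> sum c A > 0")
    case True
    then obtain A B where AB: "tight A B" "sum c A > 0"
      and least: "\<And>A' B'. tight A' B' \<Longrightarrow> sum c A' > 0 \<Longrightarrow> card A \<le> card A'"
      using exists_least_iff[of "\<lambda>m. \<exists>A B. tight A B \<and> sum c A > 0 \<and> card A = m"]
      by (metis linorder_not_less)
    have cov: "bip_cover R A B" using AB by (simp add: tight_def)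
    obtain x where x: "x \<in> A" "c x > 0"
      using AB(2) by (metis gr0I less_irrefl sum.neutral)
    \<comment> \<open>Otherwise trading \<open>x\<close> for its neighbours of weight zero gives a
      cover lighter than \<open>Suc k\<close>.\<close>
    have "\<exists>y. (x, y) \<in> R \<and> d y > 0 \<and> y \<notin> B"
    proof (rule ccontr)
      assume no: "\<not> ?thesis"
      then have no': "\<And>y. (x, y) \<in> R \<Longrightarrow> d y = 0 \<or> y \<in> B" by auto
      let ?B = "B \<union> {y. (x, y) \<in> R \<and> d y = 0}"
      have c': "bip_cover R (A - {x}) ?B"
        using cov no' unfolding bip_cover_def by blast
      have "sum d ?B = sum d B"
        using fin[OF c'] by (intro sum.mono_neutral_right) auto
      moreover have "sum c (A - {x}) + c x = sum c A"
        using fin[OF cov] x by (simp add: sum.remove)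
      ultimately show False
        using wt[OF c'] AB(1) x unfolding tight_def by linarith
    qed
    then obtain y where y: "(x, y) \<in> R" "d y > 0" "y \<notin> B" by blast
    have "\<not> (x \<in> A' \<and> y \<in> B')" if "tight A' B'" for A' B'
    proof
      assume xy: "x \<in> A' \<and> y \<in> B'"
      \<comment> \<open>The left side of this meet still contains \<open>x\<close>, so minimality of
        \<open>card A\<close> makes it all of \<open>A\<close>. The right side must then weigh as
        much as \<open>B\<close>, although it also contains \<open>y\<close>.\<close>
      have t: "tight (A \<inter> A') (B \<union> B')" by (rule lattice[OF AB(1) that])
      have fA: "finite A" using fin[OF cov] by simp
      have "c x \<le> sum c (A \<inter> A')"
        using x xy fA by (intro member_le_sum) auto
      then have "card A \<le> card (A \<inter> A')"
        using least[OF t] x by linarith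
      then have "A \<inter> A' = A"
        using fA by (metis Int_lower1 card_seteq)
      then have "sum d (B \<union> B') = sum d B"
        using t AB(1) by (simp add: tight_def)
      moreover have "sum d (insert y B) \<le> sum d (B \<union> B')"
        using fin t xy unfolding tight_def by (intro sum_mono2) auto
      moreover have "sum d (insert y B) = d y + sum d B"
        using fin[OF cov] y by simp
      ultimately show False using y by linarith
    qed
    then show ?thesis using x y by blast
  next
    case noA: False
    show ?thesis
    proof (cases "\<exists>A B. tight A B")
      case True
      then obtain A B where AB: "tight A B" by blast
      have cov: "bip_cover R A B" using AB by (simp add: tight_def)
      have "sum d B > 0" using AB noA unfolding tight_def by fastforce
      then obtain y where y: "y \<in> B" "d y > 0"
        by (metis gr0I less_irrefl sum.neutral)
      have "\<exists>x. (x, y) \<in> R \<and> c x > 0"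
      proof (rule ccontr)
        assume no: "\<not> ?thesis"
        let ?A = "A \<union> {x. (x, y) \<in> R}"
        have c': "bip_cover R ?A (B - {y})"
          using cov unfolding bip_cover_def by blast
        have "sum c ?A = sum c A"
          using fin[OF c'] no by (intro sum.mono_neutral_right) auto
        moreover have "sum d (B - {y}) + d y = sum d B"
          using fin[OF cov] y by (simp add: sum.remove)
        ultimately show False
          using wt[OF c'] AB y unfolding tight_def by linarith
      qed
      then obtain x where x: "(x, y) \<in> R" "c x > 0" by blast
      \<comment> \<open>No tight cover has positive left weight in this case.\<close>
      have "x \<notin> A'" if "tight A' B'" for A' B'
        using that noA x fin[of A' B'] member_le_sum[of x A' c] unfolding tight_def by fastforce
      then show ?thesis using x y by blast
    next
      case False
      \<comment> \<open>If every edge had an end of weight zero, the non-isolated vertices of weight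
        zero would form a cover of weight zero.\<close>
      have "\<exists>x y. (x, y) \<in> R \<and> c x > 0 \<and> d y > 0"
      proof (rule ccontr)
        assume no: "\<not> ?thesis"
        have "bip_cover R {x. (\<exists>y. (x, y) \<in> R) \<and> c x = 0} {y. (\<exists>x. (x, y) \<in> R) \<and> d y = 0}"
          using no unfolding bip_cover_def by fastforce
        from wt[OF this] show False by simp
      qed
      then show ?thesis using False by blast
    qed
  qed
  then obtain x y where xy: "(x, y) \<in> R" "c x > 0" "d y > 0"
    and nt: "\<And>A B. tight A B \<Longrightarrow> \<not> (x \<in> A \<and> y \<in> B)" by blast
  have "k \<le> sum (c(x := c x - 1)) A + sum (d(y := d y - 1)) B" if cov: "bip_cover R A B" for A B
  proof -
    \<comment> \<open>Only a cover with both \<open>x\<close> and \<open>y\<close> loses two units,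
      and such a cover is not tight, so it starts with weight at least \<open>k + 2\<close>.\<close>
    have "sum c A + sum d B \<noteq> Suc k" if "x \<in> A" "y \<in> B"
      using nt[of A B] cov that unfolding tight_def by blast
    then show ?thesis
      using sum_fun_upd_diff1[where c = c and x = x, OF fin(1)[OF cov] xy(2)]
        sum_fun_upd_diff1[where c = d and x = y, OF fin(2)[OF cov] xy(3)] wt[OF cov]
      by (cases "x \<in> A"; cases "y \<in> B"; simp del: fun_upd_apply; linarith)
  qed
  with xy show thesis by (rule that)
qed

section \<open>Evaluation of polynomials\<close>

text \<open>The general type serves degrees in \<open>nat\<close>, weights in \<open>int\<close> and
  exponent vectors alike. For exponent vectors the semiring product is used only as
  \<open>of_nat k * \<mu>\<close>, the \<open>k\<close>-fold sum.\<close>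

definition weighted_sum :: "('v \<Rightarrow> 'b::comm_semiring_1) \<Rightarrow> ('v \<Rightarrow>\<^sub>0 nat) \<Rightarrow> 'b" where
  "weighted_sum g m = (\<Sum>v\<in>Poly_Mapping.keys m. of_nat (Poly_Mapping.lookup m v) * g v)"

definition monom_eval :: "('v \<Rightarrow> 'b::comm_semiring_1) \<Rightarrow> ('v \<Rightarrow>\<^sub>0 nat) \<Rightarrow> 'b" where
  "monom_eval g m = (\<Prod>v\<in>Poly_Mapping.keys m. g v ^ Poly_Mapping.lookup m v)"

definition poly_eval ::
    "('k::comm_semiring_1 \<Rightarrow> 'b::comm_semiring_1) \<Rightarrow> ('v \<Rightarrow> 'b) \<Rightarrow> (('v \<Rightarrow>\<^sub>0 nat) \<Rightarrow>\<^sub>0 'k) \<Rightarrow> 'b" where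
  "poly_eval C g p = (\<Sum>m\<in>Poly_Mapping.keys p. C (Poly_Mapping.lookup p m) * monom_eval g m)"

lemma weighted_sum_superset:
  assumes "finite U" "Poly_Mapping.keys m \<subseteq> U"
  shows "weighted_sum g m = (\<Sum>v\<in>U. of_nat (Poly_Mapping.lookup m v) * g v)"
  unfolding weighted_sum_def
  by (rule sum.mono_neutral_left) (use assms in \<open>auto simp: in_keys_iff\<close>)

lemma weighted_sum_add: "weighted_sum g (m + m') = weighted_sum g m + weighted_sum g m'"
proof -
  let ?U = "Poly_Mapping.keys m \<union> Poly_Mapping.keys m'"
  have "Poly_Mapping.keys (m + m') \<subseteq> ?U" by (rule Poly_Mapping.keys_add)
  then show ?thesis
    by (simp add: weighted_sum_superset[of ?U] lookup_add distrib_right sum.distrib)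
qed

lemma weighted_sum_single [simp]: "weighted_sum g (Poly_Mapping.single v k) = of_nat k * g v"
  by (cases "k = 0") (simp_all add: weighted_sum_def)

lemma monom_eval_superset:
  assumes "finite U" "Poly_Mapping.keys m \<subseteq> U"
  shows "monom_eval g m = (\<Prod>v\<in>U. g v ^ Poly_Mapping.lookup m v)"
  unfolding monom_eval_def
  by (rule prod.mono_neutral_left) (use assms in \<open>auto simp: in_keys_iff\<close>)

lemma monom_eval_add: "monom_eval g (m + m') = monom_eval g m * monom_eval g m'"
proof -
  let ?U = "Poly_Mapping.keys m \<union> Poly_Mapping.keys m'"
  have "Poly_Mapping.keys (m + m') \<subseteq> ?U" by (rule Poly_Mapping.keys_add)
  then show ?thesis
    by (simp add: monom_eval_superset[of ?U] lookup_add power_add prod.distrib)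
qed

lemma monom_eval_single [simp]: "monom_eval g (Poly_Mapping.single v k) = g v ^ k"
  by (cases "k = 0") (simp_all add: monom_eval_def)

lemma monom_eval_zero [simp]: "monom_eval g 0 = 1"
  by (simp add: monom_eval_def)

lemma single_power:
  "Poly_Mapping.single m (1::'k::comm_semiring_1) ^ k = Poly_Mapping.single (of_nat k * m) 1"
  for m :: "'m::comm_semiring_1"
  by (induction k) (simp_all add: mult_single distrib_right)

lemma monom_eval_monomials:
  fixes e :: "'v \<Rightarrow> 'm::comm_semiring_1"
  shows "monom_eval (\<lambda>v. Poly_Mapping.single (e v) (1::'k::comm_semiring_1)) m
    = Poly_Mapping.single (weighted_sum e m) 1"
proof -
  have "(\<Prod>v\<in>V. Poly_Mapping.single (f v) (1::'k)) = Poly_Mapping.single (sum f V) 1"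
    for f :: "'v \<Rightarrow> 'm" and V
    by (induction V rule: infinite_finite_induct) (simp_all add: mult_single)
  then show ?thesis
    by (simp add: monom_eval_def weighted_sum_def single_power)
qed

lemma poly_mapping_sum_single:
  "p = (\<Sum>m\<in>Poly_Mapping.keys p. Poly_Mapping.single m (Poly_Mapping.lookup p m))"
proof (rule poly_mapping_eqI)
  fix m
  have "Poly_Mapping.lookup (\<Sum>m\<in>Poly_Mapping.keys p. Poly_Mapping.single m (Poly_Mapping.lookup p m)) m
     = (\<Sum>a\<in>Poly_Mapping.keys p. if a = m then Poly_Mapping.lookup p a else 0)"
    unfolding lookup_sum by (rule sum.cong) (auto simp: lookup_single when_def)
  also have "\<dots> = Poly_Mapping.lookup p m"
    by (simp add: in_keys_iff)
  finally show "Poly_Mapping.lookup p m = Poly_Mapping.lookup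
    (\<Sum>m\<in>Poly_Mapping.keys p. Poly_Mapping.single m (Poly_Mapping.lookup p m)) m" by simp
qed

locale coeff_hom =
  fixes C :: "'k::comm_ring_1 \<Rightarrow> 'b::comm_ring_1"
  assumes C_0: "C 0 = 0" and C_1: "C 1 = 1" and C_add: "C (a + b) = C a + C b"
    and C_mult: "C (a * b) = C a * C b"
begin

lemma eval_superset:
  assumes "finite U" "Poly_Mapping.keys p \<subseteq> U"
  shows "poly_eval C g p = (\<Sum>m\<in>U. C (Poly_Mapping.lookup p m) * monom_eval g m)"
  unfolding poly_eval_def
  by (rule sum.mono_neutral_left) (use assms in \<open>auto simp: in_keys_iff C_0\<close>)

lemma eval_zero [simp]: "poly_eval C g 0 = 0"
  by (simp add: poly_eval_def)

lemma eval_add: "poly_eval C g (p + q) = poly_eval C g p + poly_eval C g q"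
proof -
  let ?U = "Poly_Mapping.keys p \<union> Poly_Mapping.keys q"
  have "Poly_Mapping.keys (p + q) \<subseteq> ?U" by (rule Poly_Mapping.keys_add)
  then show ?thesis
    by (simp add: eval_superset[of ?U] lookup_add C_add distrib_right sum.distrib)
qed

lemma eval_uminus: "poly_eval C g (- p) = - poly_eval C g p"
  using eval_add[of g p "- p"] by (simp add: eq_neg_iff_add_eq_0 add.commute)

lemma eval_diff: "poly_eval C g (p - q) = poly_eval C g p - poly_eval C g q"
  using eval_add[of g p "- q"] by (simp add: eval_uminus)

lemma eval_sum: "poly_eval C g (sum f A) = (\<Sum>a\<in>A. poly_eval C g (f a))"
  by (induction A rule: infinite_finite_induct) (simp_all add: eval_add)

lemma eval_single: "poly_eval C g (Poly_Mapping.single m c) = C c * monom_eval g m"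
  by (cases "c = 0") (simp_all add: poly_eval_def C_0)

lemma eval_mult: "poly_eval C g (p * q) = poly_eval C g p * poly_eval C g q"
proof -
  have "p * q = (\<Sum>a\<in>Poly_Mapping.keys p. \<Sum>b\<in>Poly_Mapping.keys q.
      Poly_Mapping.single (a + b) (Poly_Mapping.lookup p a * Poly_Mapping.lookup q b))"
    by (subst poly_mapping_sum_single[of p], subst poly_mapping_sum_single[of q])
      (simp add: sum_product mult_single)
  then have "poly_eval C g (p * q) = (\<Sum>a\<in>Poly_Mapping.keys p. \<Sum>b\<in>Poly_Mapping.keys q.
      (C (Poly_Mapping.lookup p a) * monom_eval g a) * (C (Poly_Mapping.lookup q b) * monom_eval g b))"
    by (simp add: eval_sum eval_single C_mult monom_eval_add ac_simps)
  then show ?thesis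
    by (simp add: poly_eval_def sum_product)
qed

lemma eval_one: "poly_eval C g 1 = 1"
  using eval_single[of g 0 1] by (simp add: C_1)

end

section \<open>Leading monomials with respect to a weight\<close>

definition weight_le :: "('m \<Rightarrow> int) \<Rightarrow> int \<Rightarrow> ('m \<Rightarrow>\<^sub>0 'k::comm_ring_1) poly \<Rightarrow> bool" where
  "weight_le W w P \<longleftrightarrow> (\<forall>e. \<forall>\<mu>\<in>Poly_Mapping.keys (coeff P e). W \<mu> \<le> w)"

text \<open>\<open>W\<close> ignores the outer variable: the term with exponent \<open>\<mu>\<close>
  in degree \<open>d\<close> has to outweigh all remaining terms in every degree, while
  \<open>d\<close> records the order of vanishing of that term.\<close>

definition leading ::
    "('m::comm_monoid_add \<Rightarrow> int) \<Rightarrow> nat \<Rightarrow> 'm \<Rightarrow> ('m \<Rightarrow>\<^sub>0 'k::comm_ring_1) poly \<Rightarrow> bool" where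
  "leading W d \<mu> P \<longleftrightarrow> weight_le W (W \<mu> - 1) (P - Polynomial.monom (Poly_Mapping.single \<mu> 1) d)"

lemma weight_le_mono: "weight_le W w P \<Longrightarrow> w \<le> w' \<Longrightarrow> weight_le W w' P"
  unfolding weight_le_def by force

lemma weight_le_zero [simp]: "weight_le W w 0"
  by (simp add: weight_le_def)

lemma weight_le_add: "weight_le W w P \<Longrightarrow> weight_le W w Q \<Longrightarrow> weight_le W w (P + Q)"
  unfolding weight_le_def coeff_add using Poly_Mapping.keys_add by fastforce

lemma weight_le_monom: "W \<mu> \<le> w \<Longrightarrow> weight_le W w (Polynomial.monom (Poly_Mapping.single \<mu> c) d)"
  by (auto simp: weight_le_def)

context
  fixes W :: "'m::comm_monoid_add \<Rightarrow> int"
  assumes W_add: "\<And>\<mu> \<nu>. W (\<mu> + \<nu>) = W \<mu> + W \<nu>"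
begin

lemma weight_le_mult:
  fixes P Q :: "('m \<Rightarrow>\<^sub>0 'k::comm_ring_1) poly"
  assumes "weight_le W w P" "weight_le W w' Q"
  shows "weight_le W (w + w') (P * Q)"
  unfolding weight_le_def
proof (intro allI ballI)
  fix e \<mu> assume "\<mu> \<in> Poly_Mapping.keys (coeff (P * Q) e)"
  then have "Poly_Mapping.lookup (\<Sum>i\<le>e. coeff P i * coeff Q (e - i)) \<mu> \<noteq> 0"
    by (simp add: coeff_mult in_keys_iff)
  then obtain i where "\<mu> \<in> Poly_Mapping.keys (coeff P i * coeff Q (e - i))"
    unfolding lookup_sum in_keys_iff by (meson sum.not_neutral_contains_not_neutral)
  then obtain a b where "\<mu> = a + b" "a \<in> Poly_Mapping.keys (coeff P i)"
    "b \<in> Poly_Mapping.keys (coeff Q (e - i))"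
    using keys_mult[of "coeff P i" "coeff Q (e - i)"] by blast
  with assms show "W \<mu> \<le> w + w'"
    unfolding weight_le_def by (auto simp: W_add add_mono)
qed

text \<open>Expand both factors around their leading terms: each of the three error products has a
  factor of strictly smaller weight. Weights are integers, so strictness is a shift by one.\<close>

lemma leading_mult:
  fixes P Q :: "('m \<Rightarrow>\<^sub>0 'k::comm_ring_1) poly"
  assumes "leading W d \<mu> P" "leading W e \<nu> Q"
  shows "leading W (d + e) (\<mu> + \<nu>) (P * Q)"
proof -
  define M N where "M = Polynomial.monom (Poly_Mapping.single \<mu> (1::'k)) d"
    and "N = Polynomial.monom (Poly_Mapping.single \<nu> (1::'k)) e"
  have M: "weight_le W (W \<mu>) M" and N: "weight_le W (W \<nu>) N"
    unfolding M_def N_def by (simp_all add: weight_le_monom)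
  have P: "weight_le W (W \<mu> - 1) (P - M)" and Q: "weight_le W (W \<nu> - 1) (Q - N)"
    using assms unfolding leading_def M_def N_def by simp_all
  have "M * N = Polynomial.monom (Poly_Mapping.single (\<mu> + \<nu>) 1) (d + e)"
    by (simp add: M_def N_def mult_monom mult_single)
  moreover have "P * Q - M * N = M * (Q - N) + ((P - M) * N + (P - M) * (Q - N))"
    by (simp add: algebra_simps)
  moreover have "weight_le W (W \<mu> + W \<nu> - 1) (M * (Q - N) + ((P - M) * N + (P - M) * (Q - N)))"
    using weight_le_mult[OF M Q] weight_le_mult[OF P N] weight_le_mult[OF P Q]
    by (intro weight_le_add) (auto elim!: weight_le_mono)
  ultimately show ?thesis
    by (simp add: leading_def W_add)
qed

end

lemma leading_one: "leading W 0 0 (1 :: ('m::comm_monoid_add \<Rightarrow>\<^sub>0 'k::comm_ring_1) poly)"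
  by (simp add: leading_def monom_0 one_pCons)

lemma leading_monom_eval:
  fixes W :: "'m::comm_semiring_1 \<Rightarrow> int" and g :: "'v \<Rightarrow> ('m \<Rightarrow>\<^sub>0 'k::comm_ring_1) poly"
  assumes W_add: "\<And>\<mu> \<nu>. W (\<mu> + \<nu>) = W \<mu> + W \<nu>"
    and lead: "\<And>v. v \<in> Poly_Mapping.keys m \<Longrightarrow> leading W (d v) (e v) (g v)"
  shows "leading W (weighted_sum d m) (weighted_sum e m) (monom_eval g m)"
proof -
  have pow: "leading W (k * d v) (of_nat k * e v) (g v ^ k)" if "v \<in> Poly_Mapping.keys m" for v k
  proof (induction k)
    case 0
    show ?case using leading_one[of W] by simp
  next
    case (Suc k)
    show ?case using leading_mult[where W = W, OF W_add lead[OF that] Suc] by (simp add: distrib_right)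
  qed
  have "leading W (\<Sum>v\<in>V. Poly_Mapping.lookup m v * d v) (\<Sum>v\<in>V. of_nat (Poly_Mapping.lookup m v) * e v)
      (\<Prod>v\<in>V. g v ^ Poly_Mapping.lookup m v)" if "finite V" "V \<subseteq> Poly_Mapping.keys m" for V
    using that
  proof (induction V rule: finite_induct)
    case empty
    show ?case using leading_one[of W] by simp
  next
    case (insert v V)
    then show ?case using leading_mult[where W = W, OF W_add pow[of v]] by simp
  qed
  then show ?thesis
    by (simp add: weighted_sum_def monom_eval_def)
qed

section \<open>Minimal vertex covers of the initial graph of a closed graph\<close>

locale closed_labeling =
  fixes n :: nat and E :: "nat set set" and l :: "nat \<Rightarrow> nat"
  assumes simple: "simple_graph n E"
    and inj: "inj_on l {1..n}" and l_range: "i \<in> {1..n} \<Longrightarrow> l i \<le> n"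
    and closed: "\<lbrakk>{u, w} \<in> E; v \<in> {1..n}; l u < l v; l v < l w\<rbrakk> \<Longrightarrow> {u, v} \<in> E \<and> {v, w} \<in> E"
begin

lemma edge_vertices:
  assumes "{i, j} \<in> E"
  shows "i \<in> {1..n}" "j \<in> {1..n}" "i \<noteq> j" "l i \<noteq> l j"
proof -
  have "{i, j} \<subseteq> {1..n}" "card {i, j} = 2"
    using simple assms unfolding simple_graph_def by blast+
  then show *: "i \<in> {1..n}" "j \<in> {1..n}" "i \<noteq> j" by auto
  then show "l i \<noteq> l j" using inj by (metis inj_onD)
qed

lemma label_cong: "i \<in> {1..n} \<Longrightarrow> j \<in> {1..n} \<Longrightarrow> l i = l j \<Longrightarrow> i = j"
  using inj by (metis inj_onD)

definition arcs :: "(nat \<times> nat) set" where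
  "arcs = {(i, j). {i, j} \<in> E \<and> l i < l j}"

lemma finite_arcs: "finite arcs"
proof (rule finite_subset)
  show "arcs \<subseteq> {1..n} \<times> {1..n}" using edge_vertices by (auto simp: arcs_def)
qed simp

end

text \<open>The set \<open>A\<close> consists of the \<open>i\<close> such that \<open>x\<^sub>i\<close> belongs to a minimal vertex cover of the bipartite
  graph with the edges \<open>x\<^sub>i y\<^sub>j\<close>, where \<open>{i, j}\<close> is an edge of \<open>G\<close> and \<open>i\<close> has the smaller label;
  the set \<open>B\<close> does the same for the \<open>y\<^sub>j\<close>. The vertices in \<open>A \<inter> B\<close> form the cut set of a minimal
  prime of the binomial edge ideal, and each component of the remaining graph contains exactly one
  vertex outside \<open>A \<union> B\<close>, its pivot, which serves as the name of the component.\<close>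

locale closed_cover = closed_labeling +
  fixes A B :: "nat set"
  assumes sub: "A \<subseteq> {1..n}" "B \<subseteq> {1..n}"
    and cover: "\<lbrakk>{i, j} \<in> E; l i < l j\<rbrakk> \<Longrightarrow> i \<in> A \<or> j \<in> B"
    and minA: "i \<in> A \<Longrightarrow> \<exists>j. {i, j} \<in> E \<and> l i < l j \<and> j \<notin> B"
    and minB: "j \<in> B \<Longrightarrow> \<exists>i. {i, j} \<in> E \<and> l i < l j \<and> i \<notin> A"
begin

definition pivots :: "nat set" where
  "pivots = {1..n} - (A \<union> B)"

text \<open>Components are described by labels instead of paths: the nearest pivot above for a
  vertex of \<open>A\<close>, the nearest below for a vertex of \<open>B\<close>. For a vertex of
  \<open>A \<inter> B\<close> the two demands contradict each other, so cut vertices have no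
  pivot.\<close>

definition is_pivot :: "nat \<Rightarrow> nat \<Rightarrow> bool" where
  "is_pivot i s \<longleftrightarrow> s \<in> pivots \<and>
    (i \<in> A \<longrightarrow> l i < l s \<and> (\<forall>z\<in>pivots. l i < l z \<longrightarrow> l s \<le> l z)) \<and>
    (i \<in> B \<longrightarrow> l s < l i \<and> (\<forall>z\<in>pivots. l z < l i \<longrightarrow> l z \<le> l s)) \<and>
    (i \<notin> A \<longrightarrow> i \<notin> B \<longrightarrow> s = i)"

definition pivot :: "nat \<Rightarrow> nat" where
  "pivot i = (SOME s. is_pivot i s)"

lemma is_pivot_unique:
  assumes "is_pivot i s" "is_pivot i s'"
  shows "s = s'"
proof -
  have "s \<in> {1..n}" "s' \<in> {1..n}"
    using assms by (auto simp: is_pivot_def pivots_def)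
  moreover have "s = s' \<or> l s = l s'"
    using assms unfolding is_pivot_def by (metis order_antisym)
  ultimately show ?thesis using label_cong by blast
qed

text \<open>Minimality gives a higher neighbour outside \<open>B\<close>. If it lies in
  \<open>A\<close>, the argument repeats from there; labels are bounded, so the chain ends at a
  pivot.\<close>

lemma above_ex:
  "i \<in> A \<Longrightarrow> i \<notin> B \<Longrightarrow> \<exists>s\<in>pivots. l i < l s"
proof (induction "n - l i" arbitrary: i rule: less_induct)
  case less
  obtain k where k: "{i, k} \<in> E" "l i < l k" "k \<notin> B"
    using minA less.prems by blast
  have V: "k \<in> {1..n}" using edge_vertices k by blast
  show ?case
  proof (cases "k \<in> A")
    case True
    have "n - l k < n - l i" using l_range[OF V] k by linarith
    from less.hyps[OF this True k(3)] k(2) show ?thesis by (meson less_trans)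
  next
    case False
    with k V show ?thesis by (auto simp: pivots_def)
  qed
qed

lemma below_ex:
  "i \<in> B \<Longrightarrow> i \<notin> A \<Longrightarrow> \<exists>s\<in>pivots. l s < l i"
proof (induction "l i" arbitrary: i rule: less_induct)
  case less
  obtain k where k: "{k, i} \<in> E" "l k < l i" "k \<notin> A"
    using minB less.prems by blast
  have V: "k \<in> {1..n}" using edge_vertices k by blast
  show ?case
  proof (cases "k \<in> B")
    case True
    from less.hyps[OF k(2) True k(3)] k(2) show ?thesis by (meson less_trans)
  next
    case False
    with k V show ?thesis by (auto simp: pivots_def)
  qed
qed

lemma is_pivot_ex:
  assumes "i \<in> {1..n}" "\<not> (i \<in> A \<and> i \<in> B)"
  shows "\<exists>s. is_pivot i s"
proof -
  consider "i \<in> A" "i \<notin> B" | "i \<in> B" "i \<notin> A" | "i \<notin> A" "i \<notin> B"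
    using assms(2) by blast
  then show ?thesis
  proof cases
    case 1
    from above_ex[OF this] obtain s where s: "s \<in> pivots \<and> l i < l s" by blast
    then obtain s where "s \<in> pivots" "l i < l s" "\<And>z. z \<in> pivots \<Longrightarrow> l i < l z \<Longrightarrow> l s \<le> l z"
      using ex_has_least_nat[of "\<lambda>s. s \<in> pivots \<and> l i < l s" s l] by blast
    then show ?thesis using 1 unfolding is_pivot_def by blast
  next
    case 2
    from below_ex[OF this] obtain s where s: "s \<in> pivots \<and> l s < l i" by blast
    have "\<forall>z. z \<in> pivots \<and> l z < l i \<longrightarrow> l z < Suc n"
      using l_range[OF assms(1)] by auto
    from ex_has_greatest_nat[of "\<lambda>s. s \<in> pivots \<and> l s < l i" s l "Suc n"] s this
    obtain s where "s \<in> pivots" "l s < l i" "\<And>z. z \<in> pivots \<Longrightarrow> l z < l i \<Longrightarrow> l z \<le> l s"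
      by blast
    then show ?thesis using 2 unfolding is_pivot_def by blast
  next
    case 3
    then show ?thesis using assms(1) unfolding is_pivot_def pivots_def by blast
  qed
qed

lemma pivot_is_pivot:
  assumes "i \<in> {1..n}" "\<not> (i \<in> A \<and> i \<in> B)"
  shows "is_pivot i (pivot i)"
  unfolding pivot_def by (rule someI_ex) (rule is_pivot_ex[OF assms])

lemma pivot_eqI: "is_pivot i s \<Longrightarrow> pivot i = s"
  unfolding pivot_def by (metis is_pivot_unique someI)

text \<open>The ascending chain from \<open>i\<close> cannot jump over \<open>j\<close>: a neighbour
  \<open>k\<close> of \<open>i\<close> with \<open>k \<notin> B\<close> above \<open>j\<close> would
  be adjacent to \<open>j\<close> by closedness, and \<open>{j, k}\<close> would be
  uncovered.\<close>

lemma pivot_between: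
  assumes "{i, j} \<in> E" "l i < l j" "i \<in> A" "i \<notin> B" "j \<in> B" "j \<notin> A"
  shows "\<exists>z\<in>pivots. l i < l z \<and> l z < l j"
  using assms
proof (induction "n - l i" arbitrary: i rule: less_induct)
  case less
  obtain k where k: "{i, k} \<in> E" "l i < l k" "k \<notin> B"
    using minA less.prems by blast
  have V: "k \<in> {1..n}" "j \<in> {1..n}" using edge_vertices k less.prems by blast+
  have "k \<noteq> j" using k less.prems by blast
  moreover have "\<not> l j < l k"
    using closed[OF k(1) V(2) less.prems(2)] cover k(3) less.prems(6) by blast
  ultimately have kj: "l k < l j" using label_cong[OF V] by linarith
  show ?case
  proof (cases "k \<in> A")
    case True
    have "n - l k < n - l i" using l_range[OF V(1)] k by linarith
    moreover have "{k, j} \<in> E" using closed[OF less.prems(1) V(1) k(2) kj] by simp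
    ultimately show ?thesis
      using less.hyps[of k] kj True k less.prems by (meson less_trans)
  next
    case False
    with k V kj show ?thesis by (auto simp: pivots_def)
  qed
qed

text \<open>By closedness, a pivot strictly between the ends is adjacent to both, and covering these
  two edges forces \<open>i \<in> A\<close> and \<open>j \<in> B\<close>. In the other cases no
  pivot separates the ends, so they look at the same nearest pivot.\<close>

lemma pivot_edge_aux:
  assumes E: "{i, j} \<in> E" "l i < l j" and S: "\<not> (i \<in> A \<and> i \<in> B)" "\<not> (j \<in> A \<and> j \<in> B)"
  shows "pivot i = pivot j"
proof -
  have V: "i \<in> {1..n}" "j \<in> {1..n}" using edge_vertices E by blast+
  have between: "{i, z} \<in> E \<and> {z, j} \<in> E" if "z \<in> pivots" "l i < l z" "l z < l j" for z
    using closed[OF E(1) _ that(2,3)] that(1) by (auto simp: pivots_def)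
  have no_between: "i \<in> A \<and> j \<in> B" if "z \<in> pivots" "l i < l z" "l z < l j" for z
    using between[OF that] cover that by (auto simp: pivots_def)
  note pi = pivot_is_pivot[OF V(1) S(1)] and pj = pivot_is_pivot[OF V(2) S(2)]
  have or: "i \<in> A \<or> j \<in> B" using cover E by blast
  consider (AA) "i \<in> A" "j \<in> A" | (A0) "i \<in> A" "j \<notin> A" "j \<notin> B" | (AB) "i \<in> A" "j \<in> B"
    | (B0) "j \<in> B" "i \<notin> A" "i \<notin> B" | (BB) "i \<in> B" "j \<in> B"
    using or by blast
  then show ?thesis
  proof cases
    case AA
    have "is_pivot i (pivot j)"
      unfolding is_pivot_def
    proof (intro conjI impI ballI)
      show "pivot j \<in> pivots" "l i < l (pivot j)"
        using pj AA E by (auto simp: is_pivot_def)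
      fix z assume z: "z \<in> pivots" "l i < l z"
      have "\<not> l z < l j" using no_between[OF z] AA S by blast
      moreover have "l z \<noteq> l j"
        using z AA label_cong[of z j] V by (auto simp: pivots_def)
      ultimately show "l (pivot j) \<le> l z"
        using pj AA z by (auto simp: is_pivot_def)
    qed (use AA S in auto)
    then show ?thesis by (rule pivot_eqI)
  next
    case A0
    have "j \<in> pivots" using A0 V by (simp add: pivots_def)
    moreover have "\<And>z. z \<in> pivots \<Longrightarrow> l i < l z \<Longrightarrow> l j \<le> l z"
      using no_between A0 by (metis linorder_not_less)
    ultimately have "is_pivot i j" using A0 S E unfolding is_pivot_def by blast
    moreover have "is_pivot j j" using A0 \<open>j \<in> pivots\<close> unfolding is_pivot_def by blast
    ultimately show ?thesis using pivot_eqI by metis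
  next
    case AB
    let ?s = "pivot i"
    have s: "?s \<in> pivots" "l i < l ?s" "\<And>z. z \<in> pivots \<Longrightarrow> l i < l z \<Longrightarrow> l ?s \<le> l z"
      using pi AB unfolding is_pivot_def by blast+
    obtain z where "z \<in> pivots" "l i < l z" "l z < l j"
      using pivot_between[OF E] AB S by blast
    then have sj: "l ?s < l j" using s(3) by (meson le_less_trans)
    have "is_pivot j ?s"
      unfolding is_pivot_def
    proof (intro conjI impI ballI)
      fix z assume z: "z \<in> pivots" "l z < l j"
      show "l z \<le> l ?s"
      proof (rule ccontr)
        assume "\<not> ?thesis"
        then have sz: "l ?s < l z" by simp
        \<comment> \<open>A second pivot below \<open>j\<close> would be adjacent to
          \<open>?s\<close> by closedness, but an edge between pivots is uncovered.\<close>
        have "{?s, j} \<in> E" using between[OF s(1,2) sj] by blast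
        then have "{?s, z} \<in> E"
          using closed[OF _ _ sz z(2)] z(1) by (auto simp: pivots_def)
        with sz cover show False using s(1) z(1) by (auto simp: pivots_def)
      qed
    qed (use AB S s sj in auto)
    from pivot_eqI[OF this] show ?thesis by simp
  next
    case B0
    have "i \<in> pivots" using B0 V by (simp add: pivots_def)
    moreover have "\<And>z. z \<in> pivots \<Longrightarrow> l z < l j \<Longrightarrow> l z \<le> l i"
      using no_between B0 by (metis linorder_not_less)
    ultimately have "is_pivot j i" using B0 S E unfolding is_pivot_def by blast
    moreover have "is_pivot i i" using B0 \<open>i \<in> pivots\<close> unfolding is_pivot_def by blast
    ultimately show ?thesis using pivot_eqI by metis
  next
    case BB
    have "is_pivot j (pivot i)"
      unfolding is_pivot_def
    proof (intro conjI impI ballI)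
      show "pivot i \<in> pivots" "l (pivot i) < l j"
        using pi BB E by (auto simp: is_pivot_def)
      fix z assume z: "z \<in> pivots" "l z < l j"
      have "\<not> l i < l z" using no_between[OF z(1) _ z(2)] BB S by blast
      moreover have "l z \<noteq> l i"
        using z BB label_cong[of z i] V by (auto simp: pivots_def)
      ultimately show "l z \<le> l (pivot i)"
        using pi BB z by (auto simp: is_pivot_def)
    qed (use BB S in auto)
    from pivot_eqI[OF this] show ?thesis by simp
  qed
qed

lemma pivot_edge:
  assumes "{i, j} \<in> E" "\<not> (i \<in> A \<and> i \<in> B)" "\<not> (j \<in> A \<and> j \<in> B)"
  shows "pivot i = pivot j"
proof (cases "l i < l j")
  case True
  then show ?thesis using assms pivot_edge_aux by blast
next
  case False
  have "{j, i} \<in> E" using assms(1) by (simp add: insert_commute)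
  moreover have "l j < l i" using False edge_vertices(4)[OF assms(1)] by simp
  ultimately show ?thesis using assms pivot_edge_aux by metis
qed

lemma pivot_props:
  assumes "i \<in> {1..n}" "\<not> (i \<in> A \<and> i \<in> B)"
  shows "pivot i \<in> pivots" "i \<in> A \<Longrightarrow> l i < l (pivot i)" "i \<in> B \<Longrightarrow> l (pivot i) < l i"
    "i \<notin> A \<Longrightarrow> i \<notin> B \<Longrightarrow> pivot i = i"
  using pivot_is_pivot[OF assms] unfolding is_pivot_def by blast+

text \<open>A lower neighbour outside \<open>A\<close> has its pivot below \<open>i\<close>, an
  upper neighbour outside \<open>B\<close> has it above \<open>i\<close>. Thus \<open>i\<close>
  joins two components, which later forces \<open>x_i\<close> and \<open>y_i\<close> into every
  prime between \<open>J\<close> and the cut prime.\<close>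

lemma cut_vertex:
  assumes "i \<in> A" "i \<in> B"
  obtains u w where "{u, i} \<in> E" "{i, w} \<in> E" "\<not> (u \<in> A \<and> u \<in> B)" "\<not> (w \<in> A \<and> w \<in> B)"
    "pivot u \<noteq> pivot w"
proof -
  obtain w where w: "{i, w} \<in> E" "l i < l w" "w \<notin> B" using minA assms by blast
  obtain u where u: "{u, i} \<in> E" "l u < l i" "u \<notin> A" using minB assms by blast
  have V: "u \<in> {1..n}" "w \<in> {1..n}" using edge_vertices u w by blast+
  have "l (pivot u) \<le> l u"
    using pivot_props[OF V(1)] u by (cases "u \<in> B") auto
  moreover have "l w \<le> l (pivot w)"
    using pivot_props[OF V(2)] w by (cases "w \<in> A") auto
  ultimately have "pivot u \<noteq> pivot w" using u w by auto
  with u w show thesis by (intro that) auto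
qed

end

section \<open>Ideals of the polynomial ring\<close>

lemma polynomial_ring_simps [simp]:
  "monoid.mult (polynomial_ring n) = (*)" "monoid.one (polynomial_ring n) = 1"
  "ring.zero (polynomial_ring n) = 0" "ring.add (polynomial_ring n) = (+)"
  by (simp_all add: polynomial_ring_def)

lemma carrier_polynomial_ring:
  "p \<in> carrier (polynomial_ring n) \<longleftrightarrow>
    (\<forall>m\<in>Poly_Mapping.keys p. Poly_Mapping.keys m \<subseteq> variables n)"
  by (simp add: polynomial_ring_def)

lemma carrier_closed:
  fixes p q :: "('k::field) mpoly"
  assumes "p \<in> carrier (polynomial_ring n)" "q \<in> carrier (polynomial_ring n)"
  shows "p + q \<in> carrier (polynomial_ring n)" "p * q \<in> carrier (polynomial_ring n)"
    "- p \<in> carrier (polynomial_ring n)" "p - q \<in> carrier (polynomial_ring n)"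
proof -
  interpret cring "polynomial_ring n :: 'k mpoly ring" by (rule cring_polynomial_ring)
  show "p + q \<in> carrier (polynomial_ring n)" "p * q \<in> carrier (polynomial_ring n)"
    using add.m_closed[OF assms] m_closed[OF assms] by simp_all
  have neg: "- r \<in> carrier (polynomial_ring n)" if "r \<in> carrier (polynomial_ring n)" for r :: "'k mpoly"
    using that by (simp add: carrier_polynomial_ring in_keys_iff)
  then show "- p \<in> carrier (polynomial_ring n)" using assms by simp
  show "p - q \<in> carrier (polynomial_ring n)"
    using add.m_closed[OF assms(1) neg[OF assms(2)]] by simp
qed

lemma carrier_one: "1 \<in> carrier (polynomial_ring n)"
  and carrier_zero: "0 \<in> carrier (polynomial_ring n)"
  by (simp_all add: carrier_polynomial_ring)

lemma carrier_single:
  "Poly_Mapping.keys m \<subseteq> variables n \<Longrightarrow> Poly_Mapping.single m c \<in> carrier (polynomial_ring n)"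
  by (simp add: carrier_polynomial_ring)

lemma carrier_var_poly: "v \<in> variables n \<Longrightarrow> var_poly v \<in> carrier (polynomial_ring n)"
  unfolding var_poly_def by (rule carrier_single) simp

lemma ideal_polynomial_ringD:
  fixes I :: "('k::field) mpoly set"
  assumes "ideal I (polynomial_ring n)"
  shows "p \<in> I \<Longrightarrow> p \<in> carrier (polynomial_ring n)" "0 \<in> I"
    "p \<in> I \<Longrightarrow> q \<in> I \<Longrightarrow> p + q \<in> I" "p \<in> I \<Longrightarrow> q \<in> I \<Longrightarrow> p - q \<in> I"
    "p \<in> I \<Longrightarrow> - p \<in> I" "r \<in> carrier (polynomial_ring n) \<Longrightarrow> p \<in> I \<Longrightarrow> r * p \<in> I"
proof -
  interpret ideal I "polynomial_ring n :: 'k mpoly ring" by (rule assms)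
  show carr: "p \<in> carrier (polynomial_ring n)" if "p \<in> I" for p using that by (rule Icarr)
  show "0 \<in> I" using additive_subgroup.zero_closed[OF is_additive_subgroup] by simp
  show add: "p \<in> I \<Longrightarrow> q \<in> I \<Longrightarrow> p + q \<in> I" for p q using additive_subgroup.a_closed[OF is_additive_subgroup, of p q] by simp
  show mult: "r \<in> carrier (polynomial_ring n) \<Longrightarrow> p \<in> I \<Longrightarrow> r * p \<in> I" for r p
    using I_l_closed[of p r] by simp
  have "- 1 \<in> carrier (polynomial_ring n)"
    using carrier_closed(3)[OF carrier_one carrier_one] .
  from mult[OF this] show neg: "p \<in> I \<Longrightarrow> - p \<in> I" for p by fastforce
  show "p \<in> I \<Longrightarrow> q \<in> I \<Longrightarrow> p - q \<in> I" using add[of p "- q"] neg by simp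
qed

lemma ideal_sum:
  fixes f :: "'a \<Rightarrow> ('k::field) mpoly"
  assumes "ideal I (polynomial_ring n)" "\<And>a. a \<in> S \<Longrightarrow> f a \<in> I"
  shows "sum f S \<in> I"
  using assms(2)
  by (induction S rule: infinite_finite_induct)
    (simp_all add: ideal_polynomial_ringD(2,3)[OF assms(1)])

lemma ideal_power_0: "ideal_power R I 0 = carrier R"
  by (simp add: ideals_set_def nat_pow_def)

lemma ideal_power_Suc: "ideal_power R I (Suc k) = ideal_prod R (ideal_power R I k) I"
  by (simp add: ideals_set_def nat_pow_def)

lemma (in cring) ideal_power_ideal:
  assumes "ideal I R"
  shows "ideal (ideal_power R I k) R"
  by (induction k) (simp_all only: ideal_power_0 ideal_power_Suc oneideal ideal_prod_is_ideal assms)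

lemma idealI_polynomial_ring:
  fixes I :: "('k::field) mpoly set"
  assumes "I \<subseteq> carrier (polynomial_ring n)" "0 \<in> I" "\<And>p q. p \<in> I \<Longrightarrow> q \<in> I \<Longrightarrow> p + q \<in> I"
    and mult: "\<And>r p. r \<in> carrier (polynomial_ring n) \<Longrightarrow> p \<in> I \<Longrightarrow> r * p \<in> I"
  shows "ideal I (polynomial_ring n)"
proof -
  let ?R = "polynomial_ring n :: 'k mpoly ring"
  interpret cring ?R by (rule cring_polynomial_ring)
  show ?thesis
  proof (rule idealI)
    show "ring ?R" by (rule ring_axioms)
    show "subgroup I (add_monoid ?R)"
    proof (rule add.subgroupI)
      fix p assume p: "p \<in> I"
      have "- 1 \<in> carrier ?R" using carrier_closed(3)[OF carrier_one carrier_one] .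
      from mult[OF this p] have "- p \<in> I" by simp
      moreover have "\<ominus>\<^bsub>?R\<^esub> p = - p"
        using p assms(1) \<open>- p \<in> I\<close> by (intro minus_equality) auto
      ultimately show "\<ominus>\<^bsub>?R\<^esub> p \<in> I" by simp
    qed (use assms in auto)
    fix p r assume "p \<in> I" "r \<in> carrier ?R"
    then show "r \<otimes>\<^bsub>?R\<^esub> p \<in> I" "p \<otimes>\<^bsub>?R\<^esub> r \<in> I"
      using mult[of r p] by (simp_all add: mult.commute)
  qed
qed

lemma edge_binomial_swap: "edge_binomial j i = - edge_binomial i j"
  by (simp add: edge_binomial_def)

text \<open>The generators are oriented by the vertex numbers, the arcs by the labels; the two
  orientations differ by a sign.\<close>

lemma (in closed_labeling) edge_in_binomial_edge_ideal:
  assumes "{i, j} \<in> E"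
  shows "edge_binomial i j \<in> (binomial_edge_ideal n E :: 'k::field mpoly set)"
proof -
  interpret cring "polynomial_ring n :: 'k mpoly ring" by (rule cring_polynomial_ring)
  let ?G = "{edge_binomial i j | i j. i < j \<and> {i, j} \<in> E} :: 'k mpoly set"
  have "?G \<subseteq> carrier (polynomial_ring n)"
    by (auto intro!: edge_binomial_closed dest: edge_vertices)
  then have G: "?G \<subseteq> binomial_edge_ideal n E"
    unfolding binomial_edge_ideal_def by (rule genideal_self)
  show ?thesis
  proof (cases "i < j")
    case True
    then show ?thesis using assms G by blast
  next
    case False
    then have "j < i" "{j, i} \<in> E"
      using assms edge_vertices(3)[OF assms] by (simp_all add: insert_commute)
    then have "edge_binomial j i \<in> (binomial_edge_ideal n E :: 'k mpoly set)"
      using G by blast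
    from ideal_polynomial_ringD(5)[OF ideal_binomial_edge_ideal[OF simple] this]
    show ?thesis by (simp only: edge_binomial_swap[of i j])
  qed
qed

section \<open>The valuation of a minimal prime\<close>

primrec index :: "indet \<Rightarrow> nat" where
  "index (XVar i) = i"
| "index (YVar i) = i"

text \<open>The target of the parametrization has the indeterminates \<open>t\<^sub>i\<close>, \<open>a\<^sub>i\<close>, \<open>b\<^sub>i\<close>, \<open>X\<^sub>i\<close>, \<open>Y\<^sub>i\<close>, numbered
  by \<open>5 i, \<dots>, 5 i + 4\<close>, and the parameter \<open>\<epsilon>\<close> of the univariate polynomials.\<close>

type_synonym 'k target = "((nat \<Rightarrow>\<^sub>0 nat) \<Rightarrow>\<^sub>0 'k) poly"

primrec fresh :: "indet \<Rightarrow> nat" where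
  "fresh (XVar i) = 5 * i + 3"
| "fresh (YVar i) = 5 * i + 4"

definition const_poly :: "'k::field \<Rightarrow> 'k target" where
  "const_poly c = [:Poly_Mapping.single 0 c:]"

interpretation const_poly: coeff_hom const_poly
  by unfold_locales (simp_all add: const_poly_def single_add mult_single one_pCons mult.commute)

lemma variables_iff [simp]: "v \<in> variables n \<longleftrightarrow> index v \<in> {1..n}"
  by (cases v) (auto simp: variables_def)

lemma finite_variables [simp]: "finite (variables n)"
  by (simp add: variables_def)

lemma weighted_sum_variables:
  assumes "Poly_Mapping.keys m \<subseteq> variables n"
  shows "weighted_sum g m = (\<Sum>i\<in>{1..n}. of_nat (Poly_Mapping.lookup m (XVar i)) * g (XVar i)
    + of_nat (Poly_Mapping.lookup m (YVar i)) * g (YVar i))"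
proof -
  have "weighted_sum g m = (\<Sum>v\<in>XVar ` {1..n} \<union> YVar ` {1..n}. of_nat (Poly_Mapping.lookup m v) * g v)"
    using assms by (intro weighted_sum_superset) (auto simp: variables_def)
  also have "\<dots> = (\<Sum>v\<in>XVar ` {1..n}. of_nat (Poly_Mapping.lookup m v) * g v)
      + (\<Sum>v\<in>YVar ` {1..n}. of_nat (Poly_Mapping.lookup m v) * g v)"
    by (rule sum.union_disjoint) auto
  finally show ?thesis
    by (simp add: sum.reindex inj_on_def sum.distrib)
qed

lemma lookup_weighted_sum:
  fixes g :: "'v \<Rightarrow> nat \<Rightarrow>\<^sub>0 nat"
  shows "Poly_Mapping.lookup (weighted_sum g m) t = weighted_sum (\<lambda>v. Poly_Mapping.lookup (g v) t) m"
proof -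
  have "Poly_Mapping.lookup (of_nat k * p) t = k * Poly_Mapping.lookup p t"
    for k and p :: "nat \<Rightarrow>\<^sub>0 nat"
    by (induction k) (simp_all add: distrib_right lookup_add)
  then show ?thesis by (simp add: weighted_sum_def lookup_sum)
qed

text \<open>Orders of vanishing add over a domain and \<open>P\<close> has order zero. This removes
  the multiplier \<open>w\<close> from the definition of the symbolic power.\<close>

lemma monom_dvd_cancel:
  fixes P Q :: "'a::idom poly"
  assumes "coeff P 0 \<noteq> 0" "Polynomial.monom 1 k dvd P * Q"
  shows "Polynomial.monom 1 k dvd Q"
proof -
  have "coeff Q i = 0" if "i < k" for i
    using that
  proof (induction i rule: less_induct)
    case (less i)
    have "coeff P j * coeff Q (i - j) = 0" if "j \<in> {1..i}" for j
      using less.IH[of "i - j"] less.prems that by auto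
    then have "(\<Sum>j\<in>{1..i}. coeff P j * coeff Q (i - j)) = 0"
      by (rule sum.neutral[OF ballI])
    then have "coeff (P * Q) i = coeff P 0 * coeff Q i"
      by (simp add: coeff_mult atMost_atLeast0 sum.atLeast_Suc_atMost)
    moreover have "coeff (P * Q) i = 0"
      using assms(2) less.prems by (simp add: monom_1_dvd_iff')
    ultimately show ?case using assms(1) by simp
  qed
  then show ?thesis by (simp add: monom_1_dvd_iff')
qed

context closed_cover
begin

definition cov :: "indet set" where
  "cov = XVar ` A \<union> YVar ` B"

lemma cov_simps [simp]: "XVar i \<in> cov \<longleftrightarrow> i \<in> A" "YVar i \<in> cov \<longleftrightarrow> i \<in> B"
  by (auto simp: cov_def)

primrec slope :: "indet \<Rightarrow> nat" where
  "slope (XVar i) = 5 * pivot i + 1"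
| "slope (YVar i) = 5 * pivot i + 2"

definition base_exp :: "indet \<Rightarrow> nat \<Rightarrow>\<^sub>0 nat" where
  "base_exp v = Poly_Mapping.single (5 * index v) 1 + Poly_Mapping.single (slope v) 1"

text \<open>For \<open>\<epsilon> = 0\<close> this is the parametrization \<open>x\<^sub>i = t\<^sub>i a\<^sub>s\<close>, \<open>y\<^sub>i = t\<^sub>i b\<^sub>s\<close> with \<open>s\<close> the pivot of
  the component of \<open>i\<close>, of the variety of the minimal prime that belongs to the cut set \<open>A \<inter> B\<close>.
  The exponent of \<open>\<epsilon>\<close> is the order of vanishing along that variety; the generic directions
  \<open>\<epsilon> X\<^sub>i\<close>, \<open>\<epsilon> Y\<^sub>i\<close> are needed only for the indeterminates in the vertex cover.\<close>

definition gen :: "indet \<Rightarrow> 'k::field target" where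
  "gen v = (if index v \<in> A \<inter> B then 0 else [:Poly_Mapping.single (base_exp v) 1:])
    + (if v \<in> cov then Polynomial.monom (Poly_Mapping.single (Poly_Mapping.single (fresh v) 1) 1) 1 else 0)"

definition param :: "'k::field mpoly \<Rightarrow> 'k target" where
  "param = poly_eval const_poly gen"

definition param0 :: "'k::field mpoly \<Rightarrow> (nat \<Rightarrow>\<^sub>0 nat) \<Rightarrow>\<^sub>0 'k" where
  "param0 p = coeff (param p) 0"

lemma param_simps:
  "param 0 = 0" "param 1 = 1" "param (p + q) = param p + param q" "param (p - q) = param p - param q"
  "param (p * q) = param p * param q" "param (sum f S) = (\<Sum>a\<in>S. param (f a))"
  "param (Poly_Mapping.single m c) = const_poly c * monom_eval gen m"
  unfolding param_def
  by (simp_all add: const_poly.eval_one const_poly.eval_add const_poly.eval_diff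
      const_poly.eval_mult const_poly.eval_sum const_poly.eval_single)

lemma param0_simps:
  "param0 0 = 0" "param0 1 = 1" "param0 (p + q) = param0 p + param0 q"
  "param0 (p - q) = param0 p - param0 q"
  "param0 (p * q) = param0 p * param0 q" "param0 (sum f S) = (\<Sum>a\<in>S. param0 (f a))"
  by (simp_all add: param0_def param_simps flip: poly_0_coeff_0) (simp add: poly_sum)

lemma param0_var_poly:
  "param0 (var_poly v) = (if index v \<in> A \<inter> B then 0 else Poly_Mapping.single (base_exp v) 1)"
  by (simp add: param0_def var_poly_def param_simps gen_def const_poly.C_1)

lemma param0_single:
  "param0 (Poly_Mapping.single m c) = (if \<exists>v\<in>Poly_Mapping.keys m. index v \<in> A \<inter> B then 0
     else Poly_Mapping.single (weighted_sum base_exp m) c)"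
proof -
  have "param0 (Poly_Mapping.single m c) = Poly_Mapping.single 0 c *
      (\<Prod>v\<in>Poly_Mapping.keys m. (poly (gen v) 0) ^ Poly_Mapping.lookup m v)"
    by (simp add: param0_def param_simps const_poly_def monom_eval_def poly_prod flip: poly_0_coeff_0)
  also have "\<dots> = (if \<exists>v\<in>Poly_Mapping.keys m. index v \<in> A \<inter> B then 0
     else Poly_Mapping.single (weighted_sum base_exp m) c)"
  proof (cases "\<exists>v\<in>Poly_Mapping.keys m. index v \<in> A \<inter> B")
    case True
    then obtain v where v: "v \<in> Poly_Mapping.keys m" "index v \<in> A \<inter> B" by blast
    then have "poly (gen v :: 'a target) 0 ^ Poly_Mapping.lookup m v = 0"
      by (simp add: gen_def poly_0_coeff_0 in_keys_iff)
    then have "(\<Prod>v\<in>Poly_Mapping.keys m. (poly (gen v :: 'a target) 0) ^ Poly_Mapping.lookup m v) = 0"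
      using v(1) by (intro prod_zero) auto
    then show ?thesis using True by (simp only: if_True mult_zero_right)
  next
    case False
    then have "(\<Prod>v\<in>Poly_Mapping.keys m. (poly (gen v :: 'a target) 0) ^ Poly_Mapping.lookup m v)
        = monom_eval (\<lambda>v. Poly_Mapping.single (base_exp v) 1) m"
      unfolding monom_eval_def by (intro prod.cong) (auto simp: gen_def poly_0_coeff_0)
    then show ?thesis
      using False by (simp only: if_False monom_eval_monomials mult_single add_0 mult_1_right)
  qed
  finally show ?thesis .
qed

definition cut_prime :: "'k::field mpoly set" where
  "cut_prime = {p \<in> carrier (polynomial_ring n). param0 p = 0}"

text \<open>With \<open>p\<close> and \<open>q\<close> the pivots of \<open>i\<close> and
  \<open>j\<close>, the two sides are the monomials \<open>t_i t_j a_p b_q\<close> and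
  \<open>t_i t_j a_q b_p\<close>; comparing the exponent of \<open>a_p\<close> suffices.\<close>

lemma base_exp_swap:
  "base_exp (XVar i) + base_exp (YVar j) = base_exp (XVar j) + base_exp (YVar i) \<longleftrightarrow> pivot i = pivot j"
proof
  assume "base_exp (XVar i) + base_exp (YVar j) = base_exp (XVar j) + base_exp (YVar i)"
  then have "Poly_Mapping.lookup (base_exp (XVar i) + base_exp (YVar j)) (5 * pivot i + 1)
      = Poly_Mapping.lookup (base_exp (XVar j) + base_exp (YVar i)) (5 * pivot i + 1)" by simp
  moreover have "5 * k \<noteq> Suc (5 * h)" "5 * k + 2 \<noteq> Suc (5 * h)" for k h :: nat by presburger+
  ultimately show "pivot i = pivot j"
    by (auto simp: base_exp_def lookup_add lookup_single when_def split: if_splits)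
next
  assume "pivot i = pivot j"
  then show "base_exp (XVar i) + base_exp (YVar j) = base_exp (XVar j) + base_exp (YVar i)"
    by (simp add: base_exp_def ac_simps)
qed

lemma param0_edge_binomial:
  assumes "i \<notin> A \<inter> B" "j \<notin> A \<inter> B"
  shows "param0 (edge_binomial i j :: 'k::field mpoly) = 0 \<longleftrightarrow> pivot i = pivot j"
proof -
  have "param0 (edge_binomial i j :: 'k mpoly) =
      Poly_Mapping.single (base_exp (XVar i) + base_exp (YVar j)) 1
      - Poly_Mapping.single (base_exp (XVar j) + base_exp (YVar i)) 1"
    using assms unfolding edge_binomial_def param0_simps param0_var_poly index.simps
    by (simp only: if_False mult_single mult_1_left)
  also have "\<dots> = 0 \<longleftrightarrow> base_exp (XVar i) + base_exp (YVar j) = base_exp (XVar j) + base_exp (YVar i)"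
    by (metis eq_iff_diff_eq_0 lookup_single_eq lookup_single_not_eq one_neq_zero)
  finally show ?thesis by (simp add: base_exp_swap)
qed

text \<open>This is the kernel of a homomorphism to a domain: indeterminates numbered by naturals
  have linearly ordered exponent vectors, so there are no zero divisors.\<close>

lemma primeideal_cut_prime: "primeideal (cut_prime :: 'k::field mpoly set) (polynomial_ring n)"
proof (rule primeidealI)
  show "ideal (cut_prime :: 'k mpoly set) (polynomial_ring n)"
    by (rule idealI_polynomial_ring) (auto simp: cut_prime_def param0_simps carrier_closed carrier_zero)
  show "cring (polynomial_ring n :: 'k mpoly ring)" by (rule cring_polynomial_ring)
  have "1 \<in> carrier (polynomial_ring n)" "1 \<notin> (cut_prime :: 'k mpoly set)"
    by (simp_all add: carrier_one cut_prime_def param0_simps)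
  then show "carrier (polynomial_ring n) \<noteq> (cut_prime :: 'k mpoly set)" by metis
qed (auto simp: cut_prime_def param0_simps)

lemma edge_in_cut_prime:
  assumes "{i, j} \<in> E"
  shows "edge_binomial i j \<in> (cut_prime :: 'k::field mpoly set)"
proof -
  have "param0 (edge_binomial i j :: 'k mpoly) = 0"
  proof (cases "i \<in> A \<inter> B \<or> j \<in> A \<inter> B")
    case True
    then show ?thesis by (auto simp: edge_binomial_def param0_simps param0_var_poly)
  next
    case False
    then show ?thesis using pivot_edge[OF assms] param0_edge_binomial[of i j] by auto
  qed
  then show ?thesis
    using edge_vertices[OF assms] by (simp add: cut_prime_def edge_binomial_closed)
qed

lemma var_in_cut_prime_iff:
  assumes "index v \<in> {1..n}"
  shows "var_poly v \<in> (cut_prime :: 'k::field mpoly set) \<longleftrightarrow> index v \<in> A \<inter> B"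
  using carrier_var_poly[of v n] assms
  by (auto simp: cut_prime_def param0_var_poly poly_mapping_eq_iff fun_eq_iff lookup_single when_def)

section \<open>Minimality of the cut prime over the binomial edge ideal\<close>

context
  fixes Q :: "'k::field mpoly set"
  assumes Q: "primeideal Q (polynomial_ring n)" and JQ: "binomial_edge_ideal n E \<subseteq> Q"
    and QP: "Q \<subseteq> cut_prime"
begin

lemma Q_ideal: "ideal Q (polynomial_ring n)"
  using Q by (rule primeideal.axioms(1))

lemmas Q_rules = ideal_polynomial_ringD[OF Q_ideal]

lemma Q_comb:
  assumes "index a \<in> {1..n}" "index b \<in> {1..n}" "p \<in> Q" "q \<in> Q"
  shows "var_poly a * p + var_poly b * q \<in> Q"
  by (intro Q_rules(3,6) carrier_var_poly) (use assms in auto)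

lemma Q_prime:
  assumes "p \<in> carrier (polynomial_ring n)" "q \<in> carrier (polynomial_ring n)" "p * q \<in> Q" "p \<notin> cut_prime"
  shows "q \<in> Q"
  using primeideal.I_prime[OF Q, of p q] assms QP by auto

lemma edge_in_Q: "{i, j} \<in> E \<Longrightarrow> edge_binomial i j \<in> Q"
  using edge_in_binomial_edge_ideal JQ by blast

text \<open>A three-term relation among the 2-minors writes \<open>edge_binomial u w\<close> times
  \<open>x_i\<close> or \<open>y_i\<close> as a combination of two edge binomials at
  \<open>i\<close>. The factor \<open>edge_binomial u w\<close> avoids the cut prime because
  \<open>u\<close> and \<open>w\<close> lie in different components.\<close>

lemma cut_var_in_Q:
  assumes "index v \<in> A \<inter> B"
  shows "var_poly v \<in> Q"
proof -
  obtain i where i: "v = XVar i \<or> v = YVar i" "i \<in> A" "i \<in> B"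
    using assms by (cases v) auto
  obtain u w where uw: "{u, i} \<in> E" "{i, w} \<in> E" "\<not> (u \<in> A \<and> u \<in> B)" "\<not> (w \<in> A \<and> w \<in> B)"
    "pivot u \<noteq> pivot w"
    using cut_vertex[OF i(2,3)] by blast
  note V = edge_vertices[OF uw(1)] edge_vertices[OF uw(2)]
  have "edge_binomial u w \<notin> (cut_prime :: 'k mpoly set)"
    using param0_edge_binomial[of u w] uw by (auto simp: cut_prime_def)
  moreover have "edge_binomial u w * var_poly (XVar i) =
      var_poly (XVar w) * edge_binomial u i + var_poly (XVar u) * (edge_binomial i w :: 'k mpoly)"
    "edge_binomial u w * var_poly (YVar i) =
      var_poly (YVar w) * edge_binomial u i + var_poly (YVar u) * (edge_binomial i w :: 'k mpoly)"
    by (simp_all add: edge_binomial_def algebra_simps)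
  then have "edge_binomial u w * var_poly v \<in> Q"
    using i(1) V Q_comb[OF _ _ edge_in_Q[OF uw(1)] edge_in_Q[OF uw(2)]] by (elim disjE) simp_all
  moreover have "var_poly v \<in> carrier (polynomial_ring n)"
    using i(1) V by (intro carrier_var_poly) auto
  ultimately show ?thesis
    using Q_prime[of "edge_binomial u w" "var_poly v"] edge_binomial_closed V by blast
qed

text \<open>The same relation, now cancelling \<open>x_k\<close>, which lies outside the cut
  prime.\<close>

lemma edge_binomial_trans:
  assumes "k \<in> {1..n}" "i \<in> {1..n}" "j \<in> {1..n}" "\<not> (k \<in> A \<and> k \<in> B)"
    and "edge_binomial i k \<in> Q" "edge_binomial k j \<in> Q"
  shows "edge_binomial i j \<in> Q"
proof (rule Q_prime)
  show "var_poly (XVar k) \<notin> (cut_prime :: 'k mpoly set)"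
    using assms by (simp add: var_in_cut_prime_iff)
  have "var_poly (XVar k) * edge_binomial i j =
      var_poly (XVar j) * edge_binomial i k + var_poly (XVar i) * (edge_binomial k j :: 'k mpoly)"
    by (simp add: edge_binomial_def algebra_simps)
  then show "var_poly (XVar k) * edge_binomial i j \<in> Q"
    using Q_comb[of "XVar j" "XVar i"] assms by simp
qed (use assms in \<open>auto intro!: carrier_var_poly edge_binomial_closed\<close>)

lemma edge_binomial_pivot:
  assumes "i \<in> {1..n}" "\<not> (i \<in> A \<and> i \<in> B)"
  shows "edge_binomial i (pivot i) \<in> Q"
proof -
  have triv: "edge_binomial i i \<in> Q" for i
    using Q_rules(2) by (simp add: edge_binomial_def)
  have above: "i \<in> A \<Longrightarrow> i \<notin> B \<Longrightarrow> edge_binomial i (pivot i) \<in> Q" for i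
  proof (induction "n - l i" arbitrary: i rule: less_induct)
    case less
    obtain k where k: "{i, k} \<in> E" "l i < l k" "k \<notin> B"
      using minA less.prems by blast
    note V = edge_vertices[OF k(1)]
    have eq: "pivot i = pivot k" using pivot_edge[OF k(1)] less.prems k by blast
    have "edge_binomial k (pivot k) \<in> Q"
    proof (cases "k \<in> A")
      case True
      have "n - l k < n - l i" using l_range[OF V(2)] k by linarith
      from less.hyps[OF this True k(3)] show ?thesis .
    next
      case False
      then show ?thesis using pivot_props(4)[of k] V k triv by simp
    qed
    moreover have "pivot k \<in> {1..n}" using pivot_props(1)[of k] V k by (auto simp: pivots_def)
    ultimately show ?case
      using edge_binomial_trans[of k i "pivot k"] V k edge_in_Q[OF k(1)] eq by simp
  qed
  have below: "i \<in> B \<Longrightarrow> i \<notin> A \<Longrightarrow> edge_binomial i (pivot i) \<in> Q" for i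
  proof (induction "l i" arbitrary: i rule: less_induct)
    case less
    obtain k where k: "{k, i} \<in> E" "l k < l i" "k \<notin> A"
      using minB less.prems by blast
    then have k': "{i, k} \<in> E" by (simp add: insert_commute)
    note V = edge_vertices[OF k']
    have eq: "pivot i = pivot k" using pivot_edge[OF k'] less.prems k by blast
    have "edge_binomial k (pivot k) \<in> Q"
    proof (cases "k \<in> B")
      case True
      from less.hyps[OF k(2) True k(3)] show ?thesis .
    next
      case False
      then show ?thesis using pivot_props(4)[of k] V k triv by simp
    qed
    moreover have "pivot k \<in> {1..n}" using pivot_props(1)[of k] V k by (auto simp: pivots_def)
    ultimately show ?case
      using edge_binomial_trans[of k i "pivot k"] V k edge_in_Q[OF k'] eq by simp
  qed
  show ?thesis
    using above below pivot_props(4)[OF assms] triv assms(2) by (cases "i \<in> A"; cases "i \<in> B") auto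
qed

lemma edge_binomial_component:
  assumes "i \<in> {1..n}" "\<not> (i \<in> A \<and> i \<in> B)" "j \<in> {1..n}" "\<not> (j \<in> A \<and> j \<in> B)" "pivot i = pivot j"
  shows "edge_binomial i j \<in> Q"
proof (rule edge_binomial_trans)
  show "edge_binomial i (pivot i) \<in> Q" by (rule edge_binomial_pivot[OF assms(1,2)])
  show "edge_binomial (pivot i) j \<in> Q"
    using Q_rules(5)[OF edge_binomial_pivot[of j]] assms
    by (simp add: edge_binomial_swap[of "pivot j" j])
  show "pivot i \<in> {1..n}" "\<not> (pivot i \<in> A \<and> pivot i \<in> B)"
    using pivot_props(1)[OF assms(1,2)] by (auto simp: pivots_def)
qed (use assms in auto)

section \<open>Monomials with the same image under the parametrization\<close>

definition free_monomials :: "(indet \<Rightarrow>\<^sub>0 nat) set" where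
  "free_monomials = {m. \<forall>v\<in>Poly_Mapping.keys m. index v \<in> {1..n} - A \<inter> B}"

lemma weighted_sum_base_exp:
  assumes "m \<in> free_monomials"
  shows "i \<in> {1..n} \<Longrightarrow> Poly_Mapping.lookup (weighted_sum base_exp m) (5 * i) =
      Poly_Mapping.lookup m (XVar i) + Poly_Mapping.lookup m (YVar i)"
    and "Poly_Mapping.lookup (weighted_sum base_exp m) (5 * s + 1) =
      (\<Sum>i | i \<in> {1..n} \<and> pivot i = s. Poly_Mapping.lookup m (XVar i))"
proof -
  have keys: "Poly_Mapping.keys m \<subseteq> variables n"
    using assms by (auto simp: free_monomials_def)
  have lookup: "Poly_Mapping.lookup (weighted_sum base_exp m) t =
      (\<Sum>i\<in>{1..n}. Poly_Mapping.lookup m (XVar i) * Poly_Mapping.lookup (base_exp (XVar i)) t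
        + Poly_Mapping.lookup m (YVar i) * Poly_Mapping.lookup (base_exp (YVar i)) t)" for t
    by (simp only: lookup_weighted_sum of_nat_id
        weighted_sum_variables[OF keys, where g = "\<lambda>v. Poly_Mapping.lookup (base_exp v) t"])
  have ne: "5 * k \<noteq> Suc (5 * h)" "5 * k + 2 \<noteq> Suc (5 * h)" "Suc (5 * h) \<noteq> 5 * k"
    "Suc (Suc (5 * h)) \<noteq> 5 * k" for k h :: nat by presburger+
  have *: "Poly_Mapping.lookup (base_exp v) (5 * i) = (if index v = i then 1 else 0)" for v i
    using ne by (cases v) (auto simp: base_exp_def lookup_add lookup_single when_def)
  show "Poly_Mapping.lookup (weighted_sum base_exp m) (5 * i) =
      Poly_Mapping.lookup m (XVar i) + Poly_Mapping.lookup m (YVar i)" if "i \<in> {1..n}"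
    using that unfolding lookup *
    by (simp add: sum.distrib if_distrib[of "(*) _"] cong: if_cong)
  have **: "Poly_Mapping.lookup (base_exp (XVar i)) (5 * s + 1) = (if pivot i = s then 1 else 0)"
    "Poly_Mapping.lookup (base_exp (YVar i)) (5 * s + 1) = 0" for i
    using ne by (auto simp: base_exp_def lookup_add lookup_single when_def)
  show "Poly_Mapping.lookup (weighted_sum base_exp m) (5 * s + 1) =
      (\<Sum>i | i \<in> {1..n} \<and> pivot i = s. Poly_Mapping.lookup m (XVar i))"
    unfolding lookup **
    by (simp add: sum.If_cases if_distrib[of "(*) _"] Int_def cong: if_cong)
qed

text \<open>Equal images have equal exponents of each \<open>t_i\<close>, hence equal degree in
  \<open>x_i, y_i\<close>, and equal exponents of each \<open>a_s\<close>, hence equal total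
  \<open>x\<close>-degree on each component. A surplus in some \<open>x_i\<close> is therefore
  balanced by a deficit in the same component.\<close>

lemma exchange_pair:
  assumes m: "m \<in> free_monomials" "m' \<in> free_monomials"
    and eq: "weighted_sum base_exp m = weighted_sum base_exp m'" and ne: "m \<noteq> m'"
  obtains i j where "i \<in> {1..n}" "j \<in> {1..n}" "pivot i = pivot j"
    "Poly_Mapping.lookup m' (XVar i) < Poly_Mapping.lookup m (XVar i)"
    "Poly_Mapping.lookup m (XVar j) < Poly_Mapping.lookup m' (XVar j)"
proof -
  let ?a = "\<lambda>i. Poly_Mapping.lookup m (XVar i)" and ?a' = "\<lambda>i. Poly_Mapping.lookup m' (XVar i)"
  have deg: "?a i + Poly_Mapping.lookup m (YVar i) = ?a' i + Poly_Mapping.lookup m' (YVar i)"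
    if "i \<in> {1..n}" for i
    using weighted_sum_base_exp(1)[OF m(1) that] weighted_sum_base_exp(1)[OF m(2) that] eq by simp
  have "\<exists>i\<in>{1..n}. ?a i \<noteq> ?a' i"
  proof (rule ccontr)
    assume no: "\<not> ?thesis"
    have "Poly_Mapping.lookup m v = Poly_Mapping.lookup m' v" for v
    proof (cases "index v \<in> {1..n}")
      case True
      then show ?thesis using no deg[of "index v"] by (cases v) force+
    next
      case False
      then have "v \<notin> Poly_Mapping.keys m" "v \<notin> Poly_Mapping.keys m'"
        using m by (auto simp: free_monomials_def)
      then show ?thesis by (simp add: in_keys_iff)
    qed
    then show False using ne by (simp add: poly_mapping_eqI)
  qed
  then obtain i0 where i0: "i0 \<in> {1..n}" "?a i0 \<noteq> ?a' i0" by blast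
  define K where "K = {i. i \<in> {1..n} \<and> pivot i = pivot i0}"
  have K: "finite K" "i0 \<in> K" using i0 by (simp_all add: K_def)
  have "sum ?a K = sum ?a' K"
    using weighted_sum_base_exp(2)[OF m(1), of "pivot i0"] weighted_sum_base_exp(2)[OF m(2), of "pivot i0"]
      eq by (simp add: K_def)
  then have "\<exists>i\<in>K. ?a' i < ?a i" "\<exists>j\<in>K. ?a j < ?a' j"
    using sum_strict_mono_ex1[OF K(1), of ?a ?a'] sum_strict_mono_ex1[OF K(1), of ?a' ?a] K(2) i0(2)
    by (metis less_irrefl linorder_not_less nat_less_le)+
  then obtain i j where "i \<in> K" "j \<in> K" "?a' i < ?a i" "?a j < ?a' j" by blast
  then show thesis using that[of i j] by (auto simp: K_def)
qed

lemma monomial_exchange: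
  assumes i: "i \<in> {1..n}" and j: "j \<in> {1..n}" and p: "pivot i = pivot j" and "i \<noteq> j"
    and m: "m \<in> free_monomials"
    and pos: "Poly_Mapping.lookup m (XVar i) > 0" "Poly_Mapping.lookup m (YVar j) > 0"
  obtains m1 where "m1 \<in> free_monomials" "weighted_sum base_exp m1 = weighted_sum base_exp m"
    "Poly_Mapping.single m 1 - Poly_Mapping.single m1 1 \<in> Q"
    "\<And>k. Poly_Mapping.lookup m1 (XVar k) = (if k = i then Poly_Mapping.lookup m (XVar i) - 1
       else if k = j then Poly_Mapping.lookup m (XVar j) + 1 else Poly_Mapping.lookup m (XVar k))"
proof -
  let ?X = "\<lambda>k. Poly_Mapping.single (XVar k) (1::nat)" and ?Y = "\<lambda>k. Poly_Mapping.single (YVar k) (1::nat)"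
  define r where "r = m - (?X i + ?Y j)"
  have m_eq: "m = r + (?X i + ?Y j)"
    by (rule poly_mapping_eqI)
      (use pos in \<open>auto simp: r_def lookup_add lookup_minus lookup_single when_def\<close>)
  define m1 where "m1 = r + (?X j + ?Y i)"
  have keys_r: "Poly_Mapping.keys r \<subseteq> Poly_Mapping.keys m"
    by (auto simp: r_def in_keys_iff lookup_minus)
  have ij: "\<not> (i \<in> A \<and> i \<in> B)" "\<not> (j \<in> A \<and> j \<in> B)"
  proof -
    have "XVar i \<in> Poly_Mapping.keys m" "YVar j \<in> Poly_Mapping.keys m"
      using pos by (simp_all add: in_keys_iff)
    with m have "index (XVar i) \<in> {1..n} - A \<inter> B" "index (YVar j) \<in> {1..n} - A \<inter> B"
      unfolding free_monomials_def by blast+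
    then show "\<not> (i \<in> A \<and> i \<in> B)" "\<not> (j \<in> A \<and> j \<in> B)" by simp_all
  qed
  have m1: "m1 \<in> free_monomials"
    unfolding free_monomials_def
  proof (intro CollectI ballI)
    fix v assume "v \<in> Poly_Mapping.keys m1"
    then have "v \<in> Poly_Mapping.keys r \<or> v = XVar j \<or> v = YVar i"
      unfolding m1_def in_keys_iff lookup_add lookup_single when_def by (auto split: if_splits)
    then show "index v \<in> {1..n} - A \<inter> B"
      using keys_r m i j ij unfolding free_monomials_def by auto
  qed
  moreover have "weighted_sum base_exp m1 = weighted_sum base_exp m"
    using base_exp_swap[of i j] p by (simp add: m1_def m_eq weighted_sum_add)
  moreover have "Poly_Mapping.single m 1 - Poly_Mapping.single m1 1 =
      Poly_Mapping.single r 1 * (edge_binomial i j :: 'k mpoly)"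
    by (simp add: edge_binomial_def var_poly_def mult_single m_eq m1_def right_diff_distrib)
  moreover have "Poly_Mapping.single r (1::'k) \<in> carrier (polynomial_ring n)"
    by (rule carrier_single) (use keys_r m in \<open>auto simp: free_monomials_def\<close>)
  moreover have "edge_binomial i j \<in> Q"
    by (rule edge_binomial_component[OF i ij(1) j ij(2) p])
  moreover have "Poly_Mapping.lookup m1 (XVar k) = (if k = i then Poly_Mapping.lookup m (XVar i) - 1
       else if k = j then Poly_Mapping.lookup m (XVar j) + 1 else Poly_Mapping.lookup m (XVar k))" for k
    using \<open>i \<noteq> j\<close> by (simp add: m1_def m_eq lookup_add lookup_single when_def)
  ultimately show thesis using that[of m1] Q_rules(6) by simp
qed

text \<open>Replacing \<open>x_i y_j\<close> by \<open>x_j y_i\<close> for a surplus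
  \<open>i\<close> and a deficit \<open>j\<close> lowers the L1 distance of the
  \<open>x\<close>-exponents. The factor \<open>y_j\<close> is available since \<open>m\<close> has
  the same degree as \<open>m'\<close> in \<open>x_j, y_j\<close> but fewer
  \<open>x_j\<close>.\<close>

lemma same_image_diff_in_Q:
  assumes "m \<in> free_monomials" "m' \<in> free_monomials"
    and "weighted_sum base_exp m = weighted_sum base_exp m'"
  shows "Poly_Mapping.single m 1 - Poly_Mapping.single m' 1 \<in> Q"
  using assms(1,3)
proof (induction "\<Sum>i\<in>{1..n}. nat \<bar>int (Poly_Mapping.lookup m (XVar i)) - int (Poly_Mapping.lookup m' (XVar i))\<bar>"
    arbitrary: m rule: less_induct)
  case less
  show ?case
  proof (cases "m = m'")
    case True
    then show ?thesis using Q_rules(2) by simp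
  next
    case False
    obtain i j where ij: "i \<in> {1..n}" "j \<in> {1..n}" "pivot i = pivot j"
      "Poly_Mapping.lookup m' (XVar i) < Poly_Mapping.lookup m (XVar i)"
      "Poly_Mapping.lookup m (XVar j) < Poly_Mapping.lookup m' (XVar j)"
      using exchange_pair[OF less.prems(1) assms(2) less.prems(2) False] by blast
    have "Poly_Mapping.lookup m (YVar j) > 0"
      using weighted_sum_base_exp(1)[OF less.prems(1) ij(2)] weighted_sum_base_exp(1)[OF assms(2) ij(2)]
        less.prems(2) ij(5) by simp
    moreover have "i \<noteq> j" "Poly_Mapping.lookup m (XVar i) > 0" using ij(4,5) by auto
    ultimately obtain m1 where m1: "m1 \<in> free_monomials" "weighted_sum base_exp m1 = weighted_sum base_exp m"
      "Poly_Mapping.single m 1 - Poly_Mapping.single m1 1 \<in> Q"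
      "\<And>k. Poly_Mapping.lookup m1 (XVar k) = (if k = i then Poly_Mapping.lookup m (XVar i) - 1
         else if k = j then Poly_Mapping.lookup m (XVar j) + 1 else Poly_Mapping.lookup m (XVar k))"
      using monomial_exchange[OF ij(1-3) _ less.prems(1)] by metis
    have "Poly_Mapping.single m1 1 - Poly_Mapping.single m' 1 \<in> Q"
    proof (rule less.hyps)
      show "(\<Sum>i\<in>{1..n}. nat \<bar>int (Poly_Mapping.lookup m1 (XVar i)) - int (Poly_Mapping.lookup m' (XVar i))\<bar>)
        < (\<Sum>i\<in>{1..n}. nat \<bar>int (Poly_Mapping.lookup m (XVar i)) - int (Poly_Mapping.lookup m' (XVar i))\<bar>)"
      proof (rule sum_strict_mono_ex1)
        show "\<forall>k\<in>{1..n}. nat \<bar>int (Poly_Mapping.lookup m1 (XVar k)) - int (Poly_Mapping.lookup m' (XVar k))\<bar>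
          \<le> nat \<bar>int (Poly_Mapping.lookup m (XVar k)) - int (Poly_Mapping.lookup m' (XVar k))\<bar>"
          using ij(4,5) unfolding m1(4) by auto
        show "\<exists>k\<in>{1..n}. nat \<bar>int (Poly_Mapping.lookup m1 (XVar k)) - int (Poly_Mapping.lookup m' (XVar k))\<bar>
          < nat \<bar>int (Poly_Mapping.lookup m (XVar k)) - int (Poly_Mapping.lookup m' (XVar k))\<bar>"
          using ij(1,4) unfolding m1(4) by (intro bexI[of _ i]) auto
      qed simp
    qed (use m1 less.prems in auto)
    from Q_rules(3)[OF m1(3) this] show ?thesis by simp
  qed
qed

lemma cut_monomial_in_Q:
  assumes "Poly_Mapping.keys m \<subseteq> variables n" "v \<in> Poly_Mapping.keys m" "index v \<in> A \<inter> B"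
  shows "Poly_Mapping.single m c \<in> Q"
proof -
  define r where "r = m - Poly_Mapping.single v 1"
  have "m = r + Poly_Mapping.single v 1"
    by (rule poly_mapping_eqI)
      (use assms(2) in \<open>auto simp: r_def lookup_add lookup_minus lookup_single when_def in_keys_iff\<close>)
  then have "Poly_Mapping.single m c = Poly_Mapping.single r c * var_poly v"
    by (simp add: var_poly_def mult_single)
  moreover have "Poly_Mapping.keys r \<subseteq> Poly_Mapping.keys m"
    by (auto simp: r_def in_keys_iff lookup_minus)
  then have "Poly_Mapping.single r c \<in> carrier (polynomial_ring n)"
    using assms(1) by (intro carrier_single) blast
  ultimately show ?thesis
    using Q_rules(6) cut_var_in_Q[OF assms(3)] by simp
qed

text \<open>The kernel of a homomorphism that maps monomials to monomials or to zero is spanned by the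
  monomials mapped to zero and the differences of monomials with the same image.\<close>

lemma cut_prime_subset: "cut_prime \<subseteq> Q"
proof
  fix p :: "'k mpoly" assume "p \<in> cut_prime"
  then have p: "p \<in> carrier (polynomial_ring n)" "param0 p = 0" by (auto simp: cut_prime_def)
  let ?c = "Poly_Mapping.lookup p" and ?w = "weighted_sum base_exp"
  define T where "T = Poly_Mapping.keys p \<inter> free_monomials"
  have T: "finite T" by (simp add: T_def)
  have keys: "Poly_Mapping.keys m \<subseteq> variables n" if "m \<in> Poly_Mapping.keys p" for m
    using p(1) that by (simp add: carrier_polynomial_ring)
  have T_iff: "m \<in> T \<longleftrightarrow> \<not> (\<exists>v\<in>Poly_Mapping.keys m. index v \<in> A \<inter> B)" if "m \<in> Poly_Mapping.keys p" for m
    using keys[OF that] that by (auto simp: T_def free_monomials_def)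
  have "param0 p = (\<Sum>m\<in>Poly_Mapping.keys p. param0 (Poly_Mapping.single m (?c m)))"
    by (subst poly_mapping_sum_single[of p]) (simp only: param0_simps)
  also have "\<dots> = (\<Sum>m\<in>Poly_Mapping.keys p. if m \<in> T then Poly_Mapping.single (?w m) (?c m) else 0)"
    by (rule sum.cong) (simp_all only: param0_single T_iff if_not_P if_P split: if_splits, auto)
  also have "\<dots> = (\<Sum>m\<in>T. Poly_Mapping.single (?w m) (?c m))"
    by (simp add: sum.If_cases T_def Int_absorb1 Int_absorb2)
  finally have img: "(\<Sum>m\<in>T. Poly_Mapping.single (?w m) (?c m)) = 0" using p(2) by simp
  have fibre: "(\<Sum>m | m \<in> T \<and> ?w m = u. ?c m) = 0" for u
  proof -
    have "0 = Poly_Mapping.lookup (\<Sum>m\<in>T. Poly_Mapping.single (?w m) (?c m)) u" by (simp add: img)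
    also have "\<dots> = (\<Sum>m\<in>T. if ?w m = u then ?c m else 0)"
      by (simp add: lookup_sum lookup_single when_def)
    also have "\<dots> = (\<Sum>m | m \<in> T \<and> ?w m = u. ?c m)"
      using T by (simp add: sum.If_cases Int_def)
    finally show ?thesis by simp
  qed
  \<comment> \<open>One representative per fibre. The coefficients on a fibre sum to zero, so the
    representatives cancel and can be subtracted for free.\<close>
  define rep where "rep u = (SOME m. m \<in> T \<and> ?w m = u)" for u
  have rep: "rep (?w m) \<in> T" "?w (rep (?w m)) = ?w m" if "m \<in> T" for m
    using someI[of "\<lambda>m'. m' \<in> T \<and> ?w m' = ?w m" m] that by (auto simp: rep_def)
  have "(\<Sum>m\<in>T. Poly_Mapping.single (rep (?w m)) (?c m)) =
      (\<Sum>u\<in>?w ` T. \<Sum>m | m \<in> T \<and> ?w m = u. Poly_Mapping.single (rep (?w m)) (?c m))"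
    using T by (rule sum.image_gen)
  also have "\<dots> = (\<Sum>u\<in>?w ` T. Poly_Mapping.single (rep u) (\<Sum>m | m \<in> T \<and> ?w m = u. ?c m))"
  proof (rule sum.cong)
    fix u
    have "Poly_Mapping.single (rep u) (sum ?c M) = (\<Sum>m\<in>M. Poly_Mapping.single (rep u) (?c m))" for M
      by (induction M rule: infinite_finite_induct) (simp_all add: single_add)
    then show "(\<Sum>m | m \<in> T \<and> ?w m = u. Poly_Mapping.single (rep (?w m)) (?c m)) =
        Poly_Mapping.single (rep u) (\<Sum>m | m \<in> T \<and> ?w m = u. ?c m)"
      by (auto intro!: sum.cong)
  qed simp
  also have "\<dots> = 0" by (simp add: fibre)
  finally have reps: "(\<Sum>m\<in>T. Poly_Mapping.single (rep (?w m)) (?c m)) = 0" .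
  have "p = (\<Sum>m\<in>Poly_Mapping.keys p. Poly_Mapping.single m (?c m))"
    by (rule poly_mapping_sum_single)
  also have "\<dots> = (\<Sum>m\<in>Poly_Mapping.keys p - T. Poly_Mapping.single m (?c m))
      + (\<Sum>m\<in>T. Poly_Mapping.single m (?c m))"
    by (rule sum.subset_diff) (auto simp: T_def)
  also have "\<dots> = (\<Sum>m\<in>Poly_Mapping.keys p - T. Poly_Mapping.single m (?c m))
      + (\<Sum>m\<in>T. Poly_Mapping.single m (?c m) - Poly_Mapping.single (rep (?w m)) (?c m))"
    by (simp add: sum_subtractf reps)
  also have "\<dots> \<in> Q"
  proof (intro Q_rules(3) ideal_sum[OF Q_ideal])
    fix m assume "m \<in> Poly_Mapping.keys p - T"
    then show "Poly_Mapping.single m (?c m) \<in> Q"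
      using T_iff[of m] keys[of m] cut_monomial_in_Q by blast
  next
    fix m assume m: "m \<in> T"
    have "Poly_Mapping.single m 1 - Poly_Mapping.single (rep (?w m)) 1 \<in> Q"
      using m rep[OF m] by (intro same_image_diff_in_Q) (auto simp: T_def)
    moreover have "Poly_Mapping.single 0 (?c m) \<in> carrier (polynomial_ring n)"
      by (rule carrier_single) simp
    ultimately have "Poly_Mapping.single 0 (?c m) *
        (Poly_Mapping.single m 1 - Poly_Mapping.single (rep (?w m)) 1) \<in> Q"
      by (rule Q_rules(6)[rotated])
    then show "Poly_Mapping.single m (?c m) - Poly_Mapping.single (rep (?w m)) (?c m) \<in> Q"
      by (simp add: right_diff_distrib mult_single)
  qed
  finally show "p \<in> Q" .
qed

end

lemma cut_prime_minimal:
  "(cut_prime :: 'k::field mpoly set) \<in> minimal_primes (polynomial_ring n) (binomial_edge_ideal n E)"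
proof -
  interpret cring "polynomial_ring n :: 'k mpoly ring" by (rule cring_polynomial_ring)
  have "binomial_edge_ideal n E \<subseteq> (cut_prime :: 'k mpoly set)"
    unfolding binomial_edge_ideal_def
    using primeideal.axioms(1)[OF primeideal_cut_prime] edge_in_cut_prime
    by (intro genideal_minimal) auto
  then show ?thesis
    using primeideal_cut_prime cut_prime_subset unfolding minimal_primes_def by blast
qed

end

section \<open>Leading monomials of the elements of symbolic powers\<close>

primrec var_weight :: "nat \<Rightarrow> (nat \<Rightarrow> nat) \<Rightarrow> indet \<Rightarrow> int" where
  "var_weight n l (XVar i) = int n - int (l i)"
| "var_weight n l (YVar i) = 0"

lemma additive_weighted_sum:
  fixes W :: "'m::comm_semiring_1 \<Rightarrow> int"
  assumes "\<And>\<mu> \<nu>. W (\<mu> + \<nu>) = W \<mu> + W \<nu>"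
  shows "W (weighted_sum g m) = weighted_sum (\<lambda>v. W (g v)) m"
proof -
  have zero: "W 0 = 0" using assms[of 0 0] by simp
  have scale: "W (of_nat k * \<mu>) = of_nat k * W \<mu>" for k \<mu>
    by (induction k) (simp_all add: zero assms distrib_right)
  have "W (sum f S) = (\<Sum>a\<in>S. W (f a))" for f :: "'a \<Rightarrow> 'm" and S
    by (induction S rule: infinite_finite_induct) (simp_all add: zero assms)
  then show ?thesis by (simp add: weighted_sum_def scale)
qed

context closed_cover
begin

text \<open>The weights are chosen such that \<open>gen v\<close> has a unique term of maximal weight, and this weight
  is the one of \<open>v\<close>: it is the generic direction if \<open>v\<close> is in the cover, and the only term otherwise.\<close>

definition target_weight :: "nat \<Rightarrow> int" where
  "target_weight k = (let i = k div 5 in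
     if k mod 5 = 0 then min 0 (int (l (pivot i)) - int (l i))
     else if k mod 5 = 1 \<or> k mod 5 = 3 then int n - int (l i) else 0)"

lemma target_weight_simps:
  "target_weight (5 * i) = min 0 (int (l (pivot i)) - int (l i))"
  "target_weight (5 * i + 1) = int n - int (l i)" "target_weight (5 * i + 2) = 0"
  "target_weight (5 * i + 3) = int n - int (l i)" "target_weight (5 * i + 4) = 0"
proof -
  have "5 * i div 5 = i" "(5 * i + 1) div 5 = i" "(5 * i + 2) div 5 = i" "(5 * i + 3) div 5 = i"
    "(5 * i + 4) div 5 = i" "5 * i mod 5 = 0" "(5 * i + 1) mod 5 = 1" "(5 * i + 2) mod 5 = 2"
    "(5 * i + 3) mod 5 = 3" "(5 * i + 4) mod 5 = 4"
    by presburger+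
  then show "target_weight (5 * i) = min 0 (int (l (pivot i)) - int (l i))"
    "target_weight (5 * i + 1) = int n - int (l i)" "target_weight (5 * i + 2) = 0"
    "target_weight (5 * i + 3) = int n - int (l i)" "target_weight (5 * i + 4) = 0"
    unfolding target_weight_def Let_def by simp_all
qed

abbreviation W :: "(nat \<Rightarrow>\<^sub>0 nat) \<Rightarrow> int" where
  "W \<equiv> weighted_sum target_weight"

definition lead_exp :: "indet \<Rightarrow> nat \<Rightarrow>\<^sub>0 nat" where
  "lead_exp v = (if v \<in> cov then Poly_Mapping.single (fresh v) 1 else base_exp v)"

definition cov_deg :: "indet \<Rightarrow> nat" where
  "cov_deg v = (if v \<in> cov then 1 else 0)"

lemma W_fresh: "W (Poly_Mapping.single (fresh v) 1) = var_weight n l v"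
  by (cases v) (simp_all add: target_weight_simps)

text \<open>With \<open>p\<close> the pivot of \<open>i\<close>, these weights are
  \<open>n - max (l i) (l p)\<close> and \<open>min 0 (l p - l i)\<close>. Thus \<open>x_i\<close>
  keeps its weight exactly if \<open>p\<close> is not above \<open>i\<close>, and \<open>y_i\<close>
  exactly if \<open>p\<close> is not below.\<close>

lemma W_base_exp:
  "W (base_exp (XVar i)) = min 0 (int (l (pivot i)) - int (l i)) + (int n - int (l (pivot i)))"
  "W (base_exp (YVar i)) = min 0 (int (l (pivot i)) - int (l i))"
  using target_weight_simps[of i] target_weight_simps[of "pivot i"]
  by (simp_all add: base_exp_def weighted_sum_add)

lemma W_lead_exp:
  assumes "index v \<in> {1..n}"
  shows "W (lead_exp v) = var_weight n l v"
proof (cases "v \<in> cov")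
  case True
  then show ?thesis using W_fresh[of v] by (simp add: lead_exp_def)
next
  case False
  show ?thesis
  proof (cases v)
    case (XVar i)
    then have i: "i \<in> {1..n}" "i \<notin> A" using False assms by auto
    then have "l (pivot i) \<le> l i"
      using pivot_props[of i] by (cases "i \<in> B") auto
    then show ?thesis using False XVar by (simp add: lead_exp_def W_base_exp)
  next
    case (YVar i)
    then have i: "i \<in> {1..n}" "i \<notin> B" using False assms by auto
    then have "l i \<le> l (pivot i)"
      using pivot_props[of i] by (cases "i \<in> A") auto
    then show ?thesis using False YVar by (simp add: lead_exp_def W_base_exp)
  qed
qed

lemma W_base_exp_less:
  assumes "index v \<in> {1..n}" "v \<in> cov" "index v \<notin> A \<inter> B"
  shows "W (base_exp v) < var_weight n l v"
proof (cases v)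
  case (XVar i)
  then have "l i < l (pivot i)" using pivot_props(2)[of i] assms by auto
  then show ?thesis using XVar by (simp add: W_base_exp)
next
  case (YVar i)
  then have "l (pivot i) < l i" using pivot_props(3)[of i] assms by auto
  then show ?thesis using YVar by (simp add: W_base_exp)
qed

lemma leading_gen:
  assumes "index v \<in> {1..n}"
  shows "leading W (cov_deg v) (lead_exp v) (gen v :: 'k::field target)"
proof (cases "v \<in> cov")
  case True
  let ?b = "(if index v \<in> A \<inter> B then 0 else [:Poly_Mapping.single (base_exp v) 1:]) :: 'k target"
  have "weight_le W (var_weight n l v - 1) ?b"
  proof (cases "index v \<in> A \<inter> B")
    case True
    then show ?thesis by simp
  next
    case False
    have "weight_le W (var_weight n l v - 1) (Polynomial.monom (Poly_Mapping.single (base_exp v) (1::'k)) 0)"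
      using W_base_exp_less[OF assms \<open>v \<in> cov\<close> False] by (intro weight_le_monom) simp
    then show ?thesis using False by (simp only: monom_0 if_False)
  qed
  moreover have "gen v - Polynomial.monom (Poly_Mapping.single (lead_exp v) 1) (cov_deg v) = ?b"
    using True by (simp add: gen_def lead_exp_def cov_deg_def)
  ultimately show ?thesis
    unfolding leading_def W_lead_exp[OF assms] by simp
next
  case False
  then have "index v \<notin> A \<inter> B" by (cases v) auto
  then have "gen v - Polynomial.monom (Poly_Mapping.single (lead_exp v) 1) (cov_deg v) = (0 :: 'k target)"
    using False by (auto simp: gen_def lead_exp_def cov_deg_def monom_0)
  then show ?thesis unfolding leading_def by simp
qed

lemma lookup_lead_sum:
  assumes "Poly_Mapping.keys m \<subseteq> variables n"
  shows "i \<in> A \<Longrightarrow> Poly_Mapping.lookup (weighted_sum lead_exp m) (5 * i + 3) = Poly_Mapping.lookup m (XVar i)"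
    "i \<in> B \<Longrightarrow> Poly_Mapping.lookup (weighted_sum lead_exp m) (5 * i + 4) = Poly_Mapping.lookup m (YVar i)"
    "i \<in> {1..n} \<Longrightarrow> Poly_Mapping.lookup (weighted_sum lead_exp m) (5 * i) =
      (if i \<in> A then 0 else Poly_Mapping.lookup m (XVar i)) + (if i \<in> B then 0 else Poly_Mapping.lookup m (YVar i))"
    "Poly_Mapping.lookup (weighted_sum lead_exp m) (5 * s + 1) =
      (\<Sum>i | i \<in> {1..n} \<and> i \<notin> A \<and> pivot i = s. Poly_Mapping.lookup m (XVar i))"
proof -
  have lookup: "Poly_Mapping.lookup (weighted_sum lead_exp m) t =
      (\<Sum>i\<in>{1..n}. Poly_Mapping.lookup m (XVar i) * Poly_Mapping.lookup (lead_exp (XVar i)) t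
        + Poly_Mapping.lookup m (YVar i) * Poly_Mapping.lookup (lead_exp (YVar i)) t)" for t
    by (simp only: lookup_weighted_sum of_nat_id
        weighted_sum_variables[OF assms, where g = "\<lambda>v. Poly_Mapping.lookup (lead_exp v) t"])
  have ne: "5 * k + a = 5 * h + b \<longleftrightarrow> k = h \<and> a = b" if "a < 5" "b < 5" for k h a b :: nat
    using that by presburger
  have lead: "Poly_Mapping.lookup (lead_exp (XVar i)) (5 * h + b) =
      (if i \<in> A then (if i = h \<and> b = 3 then 1 else 0)
       else (if i = h \<and> b = 0 then 1 else 0) + (if pivot i = h \<and> b = 1 then 1 else 0))"
    "Poly_Mapping.lookup (lead_exp (YVar i)) (5 * h + b) =
      (if i \<in> B then (if i = h \<and> b = 4 then 1 else 0)
       else (if i = h \<and> b = 0 then 1 else 0) + (if pivot i = h \<and> b = 2 then 1 else 0))"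
    if "b < 5" for i h b
    using that ne[of 0 b i h] ne[of 1 b "pivot i" h] ne[of 2 b "pivot i" h] ne[of 3 b i h] ne[of 4 b i h]
    by (auto simp: lead_exp_def base_exp_def lookup_add lookup_single when_def)
  show "Poly_Mapping.lookup (weighted_sum lead_exp m) (5 * i + 3) = Poly_Mapping.lookup m (XVar i)" if "i \<in> A"
  proof -
    have "Poly_Mapping.lookup (weighted_sum lead_exp m) (5 * i + 3) =
        (\<Sum>k\<in>{1..n}. if k = i then Poly_Mapping.lookup m (XVar k) else 0)"
      unfolding lookup lead[of 3, simplified] using that by (intro sum.cong) auto
    then show ?thesis using that sub by auto
  qed
  show "Poly_Mapping.lookup (weighted_sum lead_exp m) (5 * i + 4) = Poly_Mapping.lookup m (YVar i)" if "i \<in> B"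
  proof -
    have "Poly_Mapping.lookup (weighted_sum lead_exp m) (5 * i + 4) =
        (\<Sum>k\<in>{1..n}. if k = i then Poly_Mapping.lookup m (YVar k) else 0)"
      unfolding lookup lead[of 4, simplified] using that by (intro sum.cong) auto
    then show ?thesis using that sub by auto
  qed
  show "Poly_Mapping.lookup (weighted_sum lead_exp m) (5 * i) =
      (if i \<in> A then 0 else Poly_Mapping.lookup m (XVar i)) + (if i \<in> B then 0 else Poly_Mapping.lookup m (YVar i))"
    if "i \<in> {1..n}"
  proof -
    have "Poly_Mapping.lookup (weighted_sum lead_exp m) (5 * i) =
        (\<Sum>k\<in>{1..n}. if k = i then (if i \<in> A then 0 else Poly_Mapping.lookup m (XVar k))
          + (if i \<in> B then 0 else Poly_Mapping.lookup m (YVar k)) else 0)"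
      unfolding lookup lead[of 0, simplified] by (intro sum.cong) auto
    then show ?thesis using that by auto
  qed
  have "Poly_Mapping.lookup (weighted_sum lead_exp m) (5 * s + 1) =
      (\<Sum>i\<in>{1..n}. if i \<notin> A \<and> pivot i = s then Poly_Mapping.lookup m (XVar i) else 0)"
    unfolding lookup by (intro sum.cong refl) (subst lead[of 1], simp, subst lead[of 1], simp, simp)
  then show "Poly_Mapping.lookup (weighted_sum lead_exp m) (5 * s + 1) =
      (\<Sum>i | i \<in> {1..n} \<and> i \<notin> A \<and> pivot i = s. Poly_Mapping.lookup m (XVar i))"
    by (simp add: sum.If_cases Int_def)
qed

text \<open>Fresh directions and the \<open>t_i\<close> determine all exponents except at pivots,
  where \<open>t_i\<close> only sees a sum. The exponent of \<open>a_i\<close> settles this: besides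
  \<open>x_i\<close> it collects only \<open>x_k\<close> with \<open>k \<in> B\<close>, which are
  known already, since a component has a single pivot.\<close>

lemma lead_sum_inject:
  assumes m: "Poly_Mapping.keys m \<subseteq> variables n" "Poly_Mapping.keys m' \<subseteq> variables n"
    and eq: "weighted_sum lead_exp m = weighted_sum lead_exp m'"
  shows "m = m'"
proof -
  let ?a = "\<lambda>i. Poly_Mapping.lookup m (XVar i)" and ?a' = "\<lambda>i. Poly_Mapping.lookup m' (XVar i)"
  let ?b = "\<lambda>i. Poly_Mapping.lookup m (YVar i)" and ?b' = "\<lambda>i. Poly_Mapping.lookup m' (YVar i)"
  have XA: "?a i = ?a' i" if "i \<in> A" for i
    using lookup_lead_sum(1)[OF m(1) that] lookup_lead_sum(1)[OF m(2) that] eq by simp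
  have YB: "?b i = ?b' i" if "i \<in> B" for i
    using lookup_lead_sum(2)[OF m(1) that] lookup_lead_sum(2)[OF m(2) that] eq by simp
  have T: "(if i \<in> A then 0 else ?a i) + (if i \<in> B then 0 else ?b i) =
      (if i \<in> A then 0 else ?a' i) + (if i \<in> B then 0 else ?b' i)" if "i \<in> {1..n}" for i
    using lookup_lead_sum(3)[OF m(1) that] lookup_lead_sum(3)[OF m(2) that] eq by simp
  have XB: "?a i = ?a' i" if "i \<in> B" for i
    using T[of i] XA[of i] that sub by (auto split: if_splits)
  have X: "?a i = ?a' i" if i: "i \<in> {1..n}" for i
  proof (cases "i \<in> A \<or> i \<in> B")
    case True
    then show ?thesis using XA XB by blast
  next
    case False
    define K where "K = {k. k \<in> {1..n} \<and> k \<notin> A \<and> pivot k = i}"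
    have K: "finite K" "i \<in> K" using pivot_props(4)[of i] i False by (auto simp: K_def)
    have others: "?a k = ?a' k" if "k \<in> K - {i}" for k
      using XB[of k] pivot_props(4)[of k] that by (auto simp: K_def)
    have "sum ?a K = sum ?a' K"
      using lookup_lead_sum(4)[OF m(1), of i] lookup_lead_sum(4)[OF m(2), of i] eq by (simp add: K_def)
    then have "?a i + sum ?a (K - {i}) = ?a' i + sum ?a' (K - {i})"
      using K by (simp add: sum.remove)
    moreover have "sum ?a (K - {i}) = sum ?a' (K - {i})" using others by (rule sum.cong[OF refl])
    ultimately show ?thesis by simp
  qed
  have Y: "?b i = ?b' i" if i: "i \<in> {1..n}" for i
    using T[OF i] X[OF i] YB[of i] by (auto split: if_splits)
  have "Poly_Mapping.lookup m v = Poly_Mapping.lookup m' v" for v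
  proof (cases "index v \<in> {1..n}")
    case True
    then show ?thesis using X[of "index v"] Y[of "index v"] by (cases v) simp_all
  next
    case False
    then have "v \<notin> Poly_Mapping.keys m" "v \<notin> Poly_Mapping.keys m'" using m by auto
    then show ?thesis by (simp add: in_keys_iff)
  qed
  then show ?thesis by (rule poly_mapping_eqI)
qed

text \<open>Non-leading terms of the image of \<open>m'\<close> are too light to meet the leading
  term of \<open>m\<close>, and leading terms of distinct monomials are distinct. Hence top-weight
  coefficients survive the parametrization.\<close>

lemma lookup_param_monomial:
  assumes m: "Poly_Mapping.keys m \<subseteq> variables n" "Poly_Mapping.keys m' \<subseteq> variables n"
    and le: "weighted_sum (var_weight n l) m' \<le> weighted_sum (var_weight n l) m"
  shows "Poly_Mapping.lookup (coeff (monom_eval gen m' :: 'k::field target) (weighted_sum cov_deg m))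
    (weighted_sum lead_exp m) = (if m' = m then 1 else 0)"
proof -
  let ?M = "Polynomial.monom (Poly_Mapping.single (weighted_sum lead_exp m') (1::'k)) (weighted_sum cov_deg m')"
  let ?R = "monom_eval gen m' - ?M"
  have wt: "W (weighted_sum lead_exp u) = weighted_sum (var_weight n l) u"
    if "Poly_Mapping.keys u \<subseteq> variables n" for u
  proof -
    have "W (weighted_sum lead_exp u) = weighted_sum (\<lambda>v. W (lead_exp v)) u"
      by (rule additive_weighted_sum) (rule weighted_sum_add)
    also have "\<dots> = weighted_sum (var_weight n l) u"
      unfolding weighted_sum_def[of _ u] using that by (intro sum.cong) (auto simp: W_lead_exp)
    finally show ?thesis .
  qed
  have "leading W (weighted_sum cov_deg m') (weighted_sum lead_exp m') (monom_eval gen m' :: 'k target)"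
    by (rule leading_monom_eval) (use m in \<open>auto simp: weighted_sum_add intro!: leading_gen\<close>)
  then have "weight_le W (weighted_sum (var_weight n l) m' - 1) ?R"
    unfolding leading_def wt[OF m(2)] .
  then have "weighted_sum lead_exp m \<notin> Poly_Mapping.keys (coeff ?R (weighted_sum cov_deg m))"
    using le wt[OF m(1)] unfolding weight_le_def by force
  then have "Poly_Mapping.lookup (coeff (monom_eval gen m') (weighted_sum cov_deg m)) (weighted_sum lead_exp m)
      = Poly_Mapping.lookup (coeff ?M (weighted_sum cov_deg m)) (weighted_sum lead_exp m)"
    by (simp add: in_keys_iff lookup_minus)
  also have "\<dots> = (if m' = m then 1 else 0)"
    using lead_sum_inject[OF m(2,1)] by (auto simp: lookup_single when_def)
  finally show ?thesis .
qed

lemma lookup_param_leading: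
  fixes f :: "'k::field mpoly"
  assumes f: "f \<in> carrier (polynomial_ring n)" and m: "m \<in> Poly_Mapping.keys f"
    and top: "\<And>m'. m' \<in> Poly_Mapping.keys f \<Longrightarrow>
      weighted_sum (var_weight n l) m' \<le> weighted_sum (var_weight n l) m"
  shows "Poly_Mapping.lookup (coeff (param f) (weighted_sum cov_deg m)) (weighted_sum lead_exp m)
    = Poly_Mapping.lookup f m"
proof -
  have keys: "Poly_Mapping.keys u \<subseteq> variables n" if "u \<in> Poly_Mapping.keys f" for u
    using f that by (simp add: carrier_polynomial_ring)
  have scale: "Poly_Mapping.lookup (coeff (const_poly c * P) d) \<mu> = c * Poly_Mapping.lookup (coeff P d) \<mu>"
    for c and P :: "'k target" and d \<mu>
    by (simp add: const_poly_def flip: mult_map_scale_conv_mult) (simp add: map.rep_eq when_def)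
  have "param f = (\<Sum>u\<in>Poly_Mapping.keys f. const_poly (Poly_Mapping.lookup f u) * monom_eval gen u)"
    by (simp add: param_def poly_eval_def)
  then have "Poly_Mapping.lookup (coeff (param f) (weighted_sum cov_deg m)) (weighted_sum lead_exp m)
      = (\<Sum>u\<in>Poly_Mapping.keys f. Poly_Mapping.lookup f u * (if u = m then 1 else 0))"
    by (simp add: coeff_sum lookup_sum scale lookup_param_monomial[OF keys[OF m] keys top])
  also have "\<dots> = (\<Sum>u\<in>Poly_Mapping.keys f. if u = m then Poly_Mapping.lookup f u else 0)"
    by (rule sum.cong) auto
  also have "\<dots> = Poly_Mapping.lookup f m" using m by simp
  finally show ?thesis .
qed

text \<open>\<open>J\<close> lies in the cut prime, so its members vanish at parameter zero; each
  further factor from \<open>J\<close> contributes one power of the parameter.\<close>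

lemma param_power_dvd:
  "f \<in> ideal_power (polynomial_ring n) (binomial_edge_ideal n E) k \<Longrightarrow> Polynomial.monom 1 k dvd param f"
  for f :: "'k::field mpoly"
proof (induction k arbitrary: f)
  case 0
  then show ?case by (simp add: monom_0 flip: one_pCons)
next
  case (Suc k)
  have J: "Polynomial.monom 1 1 dvd param g" if "g \<in> binomial_edge_ideal n E" for g :: "'k mpoly"
  proof -
    have "param0 g = 0"
      using cut_prime_minimal that by (auto simp: minimal_primes_def cut_prime_def)
    then show ?thesis by (simp add: monom_1_dvd_iff' param0_def)
  qed
  from Suc.prems have "f \<in> ideal_prod (polynomial_ring n)
      (ideal_power (polynomial_ring n) (binomial_edge_ideal n E) k) (binomial_edge_ideal n E)"
    by (simp only: ideal_power_Suc)
  then show ?case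
  proof (induction f rule: ideal_prod.induct)
    case (prod p q)
    have "Polynomial.monom 1 k * Polynomial.monom 1 1 dvd param p * param q"
      by (rule mult_dvd_mono[OF Suc.IH[OF prod(1)] J[OF prod(2)]])
    then show ?case by (simp add: mult_monom param_simps)
  next
    case (sum p q)
    then show ?case by (simp add: param_simps)
  qed
qed

lemma symbolic_power_leading:
  fixes f :: "'k::field mpoly"
  assumes f: "f \<in> symbolic_power (polynomial_ring n) (binomial_edge_ideal n E) k"
    and m: "m \<in> Poly_Mapping.keys f"
    and top: "\<And>m'. m' \<in> Poly_Mapping.keys f \<Longrightarrow>
      weighted_sum (var_weight n l) m' \<le> weighted_sum (var_weight n l) m"
  shows "k \<le> (\<Sum>i\<in>A. Poly_Mapping.lookup m (XVar i)) + (\<Sum>j\<in>B. Poly_Mapping.lookup m (YVar j))"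
proof -
  obtain w where w: "w \<in> carrier (polynomial_ring n)" "w \<notin> (cut_prime :: 'k mpoly set)"
    "w * f \<in> ideal_power (polynomial_ring n) (binomial_edge_ideal n E) k"
    and carr: "f \<in> carrier (polynomial_ring n)"
    using f cut_prime_minimal unfolding symbolic_power_def by auto
  have "Polynomial.monom 1 k dvd param w * param f"
    using param_power_dvd[OF w(3)] by (simp add: param_simps)
  moreover have "coeff (param w) 0 \<noteq> 0"
    using w by (simp add: cut_prime_def param0_def)
  ultimately have dvd: "Polynomial.monom 1 k dvd param f"
    using monom_dvd_cancel by blast
  have "coeff (param f) (weighted_sum cov_deg m) \<noteq> 0"
    using lookup_param_leading[OF carr m top] m by (auto simp: in_keys_iff)
  then have "k \<le> weighted_sum cov_deg m"
    using dvd unfolding monom_1_dvd_iff' by (meson linorder_not_less)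
  also have "weighted_sum cov_deg m =
      (\<Sum>i\<in>{1..n}. if i \<in> A then Poly_Mapping.lookup m (XVar i) else 0)
      + (\<Sum>i\<in>{1..n}. if i \<in> B then Poly_Mapping.lookup m (YVar i) else 0)"
    using carr m by (subst weighted_sum_variables[where n = n])
      (auto simp: carrier_polynomial_ring cov_deg_def if_distrib[of "(*) _"] sum.distrib cong: if_cong)
  also have "\<dots> = (\<Sum>i\<in>A. Poly_Mapping.lookup m (XVar i)) + (\<Sum>j\<in>B. Poly_Mapping.lookup m (YVar j))"
    using sub by (simp add: sum.If_cases Int_absorb1 flip: sum.inter_restrict)
  finally show ?thesis .
qed

end

section \<open>Division by products of edge binomials\<close>

context closed_labeling
begin

abbreviation \<omega> :: "(indet \<Rightarrow>\<^sub>0 nat) \<Rightarrow> int" where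
  "\<omega> \<equiv> weighted_sum (var_weight n l)"

lemma weight_nonneg:
  assumes "Poly_Mapping.keys m \<subseteq> variables n"
  shows "\<omega> m \<ge> 0"
  unfolding weighted_sum_def
proof (rule sum_nonneg)
  fix v assume "v \<in> Poly_Mapping.keys m"
  then have "index v \<in> {1..n}" using assms by auto
  then have "var_weight n l v \<ge> 0" using l_range by (cases v) auto
  then show "of_nat (Poly_Mapping.lookup m v) * var_weight n l v \<ge> 0" by simp
qed

lemma closed_cover_ex:
  assumes "bip_cover arcs A0 B0"
  obtains A B where "closed_cover n E l A B" "A \<subseteq> A0" "B \<subseteq> B0"
proof -
  obtain A B where AB: "bip_cover arcs A B" "A \<subseteq> A0" "B \<subseteq> B0"
    "\<And>x. x \<in> A \<Longrightarrow> \<exists>y. (x, y) \<in> arcs \<and> y \<notin> B" "\<And>y. y \<in> B \<Longrightarrow> \<exists>x. (x, y) \<in> arcs \<and> x \<notin> A"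
    using bip_cover_subset[OF assms] by metis
  have "closed_cover n E l A B"
  proof unfold_locales
    show "A \<subseteq> {1..n}" "B \<subseteq> {1..n}"
      using AB(4,5) edge_vertices by (auto simp: arcs_def) blast+
  qed (use AB in \<open>auto simp: arcs_def bip_cover_def\<close>)
  with AB show thesis by (intro that)
qed

text \<open>Each step splits an arc off \<open>m\<close> without lowering the degree in any cover
  below \<open>k\<close>, and puts the edge binomial in its place. The result is an element of the
  power with leading term \<open>m\<close>.\<close>

lemma monomial_reduction:
  assumes "Poly_Mapping.keys m \<subseteq> variables n"
    and "\<And>A B. bip_cover arcs A B \<Longrightarrow>
      k \<le> (\<Sum>i\<in>A. Poly_Mapping.lookup m (XVar i)) + (\<Sum>j\<in>B. Poly_Mapping.lookup m (YVar j))"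
  shows "\<exists>g \<in> ideal_power (polynomial_ring n) (binomial_edge_ideal n E :: 'k::field mpoly set) k.
    \<forall>u\<in>Poly_Mapping.keys (g - Poly_Mapping.single m 1). \<omega> u < \<omega> m"
  using assms
proof (induction k arbitrary: m)
  case 0
  have "Poly_Mapping.single m (1::'k) \<in> carrier (polynomial_ring n)"
    by (rule carrier_single[OF "0.prems"(1)])
  then show ?case by (intro bexI[of _ "Poly_Mapping.single m 1"]) (simp_all only: ideal_power_0, simp)
next
  case (Suc k)
  obtain x y where xy: "(x, y) \<in> arcs" "Poly_Mapping.lookup m (XVar x) > 0" "Poly_Mapping.lookup m (YVar y) > 0"
    and red: "\<And>A B. bip_cover arcs A B \<Longrightarrow>
      k \<le> sum ((\<lambda>i. Poly_Mapping.lookup m (XVar i))(x := Poly_Mapping.lookup m (XVar x) - 1)) A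
        + sum ((\<lambda>i. Poly_Mapping.lookup m (YVar i))(y := Poly_Mapping.lookup m (YVar y) - 1)) B"
    using bip_cover_reduce[OF finite_arcs, of k "\<lambda>i. Poly_Mapping.lookup m (XVar i)"
        "\<lambda>i. Poly_Mapping.lookup m (YVar i)"] Suc.prems(2) by blast
  let ?s = "\<lambda>i j. Poly_Mapping.single (XVar i) (1::nat) + Poly_Mapping.single (YVar j) 1"
  define r where "r = m - ?s x y"
  have m_eq: "m = r + ?s x y"
    by (rule poly_mapping_eqI)
      (use xy in \<open>auto simp: r_def lookup_add lookup_minus lookup_single when_def\<close>)
  have keys_r: "Poly_Mapping.keys r \<subseteq> variables n"
    using Suc.prems(1) by (auto simp: r_def in_keys_iff lookup_minus)
  have X: "(\<lambda>i. Poly_Mapping.lookup m (XVar i))(x := Poly_Mapping.lookup m (XVar x) - 1) =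
      (\<lambda>i. Poly_Mapping.lookup r (XVar i))"
    and Y: "(\<lambda>i. Poly_Mapping.lookup m (YVar i))(y := Poly_Mapping.lookup m (YVar y) - 1) =
      (\<lambda>i. Poly_Mapping.lookup r (YVar i))"
    by (auto simp: r_def lookup_add lookup_minus lookup_single when_def fun_eq_iff)
  obtain g where g: "g \<in> ideal_power (polynomial_ring n) (binomial_edge_ideal n E :: 'k mpoly set) k"
    "\<And>u. u \<in> Poly_Mapping.keys (g - Poly_Mapping.single r 1) \<Longrightarrow> \<omega> u < \<omega> r"
    using Suc.IH[OF keys_r] red unfolding X Y by blast
  let ?f = "edge_binomial x y :: 'k mpoly"
  have f: "?f = Poly_Mapping.single (?s x y) 1 - Poly_Mapping.single (?s y x) 1"
    by (simp add: edge_binomial_def var_poly_def mult_single)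
  \<comment> \<open>The weights are \<open>n - l y\<close> and \<open>n - l x\<close>, and labels
    increase along arcs.\<close>
  have less: "\<omega> (?s y x) < \<omega> (?s x y)"
    using xy(1) by (simp add: arcs_def weighted_sum_add)
  have "?f \<in> binomial_edge_ideal n E"
    using xy(1) by (intro edge_in_binomial_edge_ideal) (simp add: arcs_def)
  then have "g * ?f \<in> ideal_power (polynomial_ring n) (binomial_edge_ideal n E) (Suc k)"
    using ideal_prod.prod[OF g(1), of ?f "binomial_edge_ideal n E" "polynomial_ring n"]
    by (simp only: ideal_power_Suc polynomial_ring_simps)
  moreover have "\<omega> u < \<omega> m" if u: "u \<in> Poly_Mapping.keys (g * ?f - Poly_Mapping.single m 1)" for u
  proof -
    have "g * ?f - Poly_Mapping.single m 1 =
        (g - Poly_Mapping.single r 1) * ?f - Poly_Mapping.single (r + ?s y x) 1"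
      by (simp add: f m_eq algebra_simps mult_single)
    then have "u \<in> Poly_Mapping.keys ((g - Poly_Mapping.single r 1) * ?f) \<or> u = r + ?s y x"
      using u by (auto simp: in_keys_iff lookup_minus lookup_single when_def split: if_splits)
    then show ?thesis
    proof
      assume "u = r + ?s y x"
      then show ?thesis using less by (simp add: m_eq weighted_sum_add)
    next
      assume "u \<in> Poly_Mapping.keys ((g - Poly_Mapping.single r 1) * ?f)"
      then obtain a b where ab: "u = a + b" "a \<in> Poly_Mapping.keys (g - Poly_Mapping.single r 1)"
        "b \<in> Poly_Mapping.keys ?f"
        using keys_mult[of "g - Poly_Mapping.single r 1" ?f] by blast
      have "b = ?s x y \<or> b = ?s y x"
        using ab(3) unfolding f
        by (auto simp: in_keys_iff lookup_minus lookup_single when_def split: if_splits)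
      then have "\<omega> b \<le> \<omega> (?s x y)" using less by auto
      then show ?thesis using g(2)[OF ab(2)] by (simp add: ab(1) m_eq weighted_sum_add)
    qed
  qed
  ultimately show ?case by blast
qed

lemma ideal_power_is_ideal:
  "ideal (ideal_power (polynomial_ring n) (binomial_edge_ideal n E :: 'k::field mpoly set) k) (polynomial_ring n)"
  using cring.ideal_power_ideal[OF cring_polynomial_ring ideal_binomial_edge_ideal[OF simple]] .

lemma ideal_power_subset_symbolic_power:
  "ideal_power (polynomial_ring n) (binomial_edge_ideal n E :: 'k::field mpoly set) k
    \<subseteq> symbolic_power (polynomial_ring n) (binomial_edge_ideal n E) k"
proof
  interpret cring "polynomial_ring n :: 'k mpoly ring" by (rule cring_polynomial_ring)
  fix f :: "'k mpoly" assume f: "f \<in> ideal_power (polynomial_ring n) (binomial_edge_ideal n E) k"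
  have "1 \<notin> P" if "primeideal P (polynomial_ring n)" for P :: "'k mpoly set"
    using primeideal.I_notcarr[OF that] ideal.one_imp_carrier[OF primeideal.axioms(1)[OF that]] by auto
  then have "(1 :: 'k mpoly) \<notin> \<Union>(minimal_primes (polynomial_ring n) (binomial_edge_ideal n E))"
    unfolding minimal_primes_def by blast
  then show "f \<in> symbolic_power (polynomial_ring n) (binomial_edge_ideal n E) k"
    using f ideal_polynomial_ringD(1)[OF ideal_power_is_ideal f] carrier_one
    unfolding symbolic_power_def by (auto intro!: bexI[of _ 1])
qed

lemma symbolic_power_diff:
  fixes f g :: "'k::field mpoly"
  assumes "f \<in> symbolic_power (polynomial_ring n) (binomial_edge_ideal n E) k"
    and g: "g \<in> ideal_power (polynomial_ring n) (binomial_edge_ideal n E) k"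
  shows "f - g \<in> symbolic_power (polynomial_ring n) (binomial_edge_ideal n E) k"
proof -
  note rules = ideal_polynomial_ringD[OF ideal_power_is_ideal]
  obtain w where w: "w \<in> carrier (polynomial_ring n)"
    "w \<notin> \<Union>(minimal_primes (polynomial_ring n) (binomial_edge_ideal n E :: 'k mpoly set))"
    "w * f \<in> ideal_power (polynomial_ring n) (binomial_edge_ideal n E) k"
    and f: "f \<in> carrier (polynomial_ring n)"
    using assms(1) unfolding symbolic_power_def by auto
  have "w * (f - g) \<in> ideal_power (polynomial_ring n) (binomial_edge_ideal n E) k"
    using rules(4)[OF w(3) rules(6)[OF w(1) g]] by (simp add: right_diff_distrib)
  then show ?thesis
    using w(1,2) carrier_closed(4)[OF f rules(1)[OF g]] unfolding symbolic_power_def by auto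
qed

text \<open>Weights are nonnegative integers, so a strict bound on them serves as induction
  parameter. Subtracting \<open>h\<close> removes the layer of weight \<open>N\<close> and stays
  inside the symbolic power.\<close>

lemma symbolic_power_reduce:
  fixes f :: "'k::field mpoly"
  assumes "f \<in> symbolic_power (polynomial_ring n) (binomial_edge_ideal n E) k"
    and "\<forall>m\<in>Poly_Mapping.keys f. \<omega> m < int N"
  shows "f \<in> ideal_power (polynomial_ring n) (binomial_edge_ideal n E) k"
  using assms
proof (induction N arbitrary: f)
  case 0
  have "Poly_Mapping.keys f = {}"
  proof (rule ccontr)
    assume "Poly_Mapping.keys f \<noteq> {}"
    then obtain m where m: "m \<in> Poly_Mapping.keys f" by blast
    have "Poly_Mapping.keys m \<subseteq> variables n"
      using "0.prems"(1) m by (auto simp: symbolic_power_def carrier_polynomial_ring)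
    then show False using weight_nonneg[of m] "0.prems"(2) m by force
  qed
  then show ?case using ideal_polynomial_ringD(2)[OF ideal_power_is_ideal] by simp
next
  case (Suc N)
  note rules = ideal_polynomial_ringD[OF ideal_power_is_ideal]
  let ?J = "ideal_power (polynomial_ring n) (binomial_edge_ideal n E :: 'k mpoly set) k"
  define M where "M = {m \<in> Poly_Mapping.keys f. \<omega> m = int N}"
  have keys: "Poly_Mapping.keys m \<subseteq> variables n" if "m \<in> Poly_Mapping.keys f" for m
    using Suc.prems(1) that by (auto simp: symbolic_power_def carrier_polynomial_ring)
  have "\<exists>g\<in>?J. \<forall>u\<in>Poly_Mapping.keys (g - Poly_Mapping.single m 1). \<omega> u < \<omega> m" if "m \<in> M" for m
  proof (rule monomial_reduction)
    have m: "m \<in> Poly_Mapping.keys f" "\<omega> m = int N" using that by (auto simp: M_def)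
    then show "Poly_Mapping.keys m \<subseteq> variables n" using keys by blast
    fix A0 B0 assume cov: "bip_cover arcs A0 B0"
    from closed_cover_ex[OF cov] obtain A B where AB: "closed_cover n E l A B" "A \<subseteq> A0" "B \<subseteq> B0" .
    have "k \<le> (\<Sum>i\<in>A. Poly_Mapping.lookup m (XVar i)) + (\<Sum>j\<in>B. Poly_Mapping.lookup m (YVar j))"
      using closed_cover.symbolic_power_leading[OF AB(1) Suc.prems(1) m(1)] Suc.prems(2) m(2) by force
    \<comment> \<open>The valuation controls minimal covers only; exponents are nonnegative, so the
      bound passes to every larger cover.\<close>
    also have "\<dots> \<le> (\<Sum>i\<in>A0. Poly_Mapping.lookup m (XVar i)) + (\<Sum>j\<in>B0. Poly_Mapping.lookup m (YVar j))"
      using AB(2,3) finite_bip_cover[OF cov finite_arcs] by (intro add_mono sum_mono2) auto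
    finally show "k \<le> (\<Sum>i\<in>A0. Poly_Mapping.lookup m (XVar i)) + (\<Sum>j\<in>B0. Poly_Mapping.lookup m (YVar j))" .
  qed
  then have "\<forall>m\<in>M. \<exists>g. g \<in> ?J \<and> (\<forall>u\<in>Poly_Mapping.keys (g - Poly_Mapping.single m 1). \<omega> u < \<omega> m)"
    by blast
  from bchoice[OF this] obtain g where g: "\<And>m. m \<in> M \<Longrightarrow> g m \<in> ?J"
    "\<And>m u. m \<in> M \<Longrightarrow> u \<in> Poly_Mapping.keys (g m - Poly_Mapping.single m 1) \<Longrightarrow> \<omega> u < \<omega> m"
    by blast
  let ?c = "Poly_Mapping.lookup f"
  define h where "h = (\<Sum>m\<in>M. Poly_Mapping.single 0 (?c m) * g m)"
  have h: "h \<in> ?J"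
    unfolding h_def
    by (intro ideal_sum[OF ideal_power_is_ideal] rules(6) g(1) carrier_single) auto
  have "\<omega> u < int N" if u: "u \<in> Poly_Mapping.keys (f - h)" for u
  proof (rule ccontr)
    assume N: "\<not> \<omega> u < int N"
    have "Poly_Mapping.lookup (g m) u = (if m = u then 1 else 0)" if "m \<in> M" for m
    proof -
      have "u \<notin> Poly_Mapping.keys (g m - Poly_Mapping.single m 1)"
        using g(2)[OF that, of u] N that by (auto simp: M_def)
      then show ?thesis by (auto simp: in_keys_iff lookup_minus lookup_single when_def)
    qed
    then have "Poly_Mapping.lookup h u = (\<Sum>m\<in>M. if m = u then ?c m else 0)"
      unfolding h_def lookup_sum mult_map_scale_conv_mult[symmetric]
      by (intro sum.cong) (auto simp: map.rep_eq when_def)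
    also have "\<dots> = (if u \<in> M then ?c u else 0)" by (simp add: M_def)
    finally have hu: "Poly_Mapping.lookup h u = (if u \<in> M then ?c u else 0)" .
    have "?c u = 0 \<or> u \<in> M"
    proof (cases "u \<in> Poly_Mapping.keys f")
      case True
      then have "\<omega> u < int (Suc N)" using Suc.prems(2) by blast
      then show ?thesis using True N by (simp add: M_def)
    qed (simp add: in_keys_iff)
    then have "Poly_Mapping.lookup (f - h) u = 0" by (auto simp: lookup_minus hu)
    then show False using u by (simp add: in_keys_iff)
  qed
  then have "f - h \<in> ?J"
    using Suc.IH[of "f - h"] symbolic_power_diff[OF Suc.prems(1) h] by blast
  from rules(3)[OF this h] show ?case by simp
qed

lemma symbolic_power_eq:
  "symbolic_power (polynomial_ring n) (binomial_edge_ideal n E :: 'k::field mpoly set) k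
    = ideal_power (polynomial_ring n) (binomial_edge_ideal n E) k"
proof (rule antisym[OF subsetI ideal_power_subset_symbolic_power])
  fix f :: "'k mpoly" assume f: "f \<in> symbolic_power (polynomial_ring n) (binomial_edge_ideal n E) k"
  have "\<omega> m < int (nat (Max (insert 0 (\<omega> ` Poly_Mapping.keys f))) + 1)" if "m \<in> Poly_Mapping.keys f" for m
  proof -
    have "\<omega> m \<le> Max (insert 0 (\<omega> ` Poly_Mapping.keys f))" using that by (intro Max_ge) auto
    then show ?thesis by linarith
  qed
  then show "f \<in> ideal_power (polynomial_ring n) (binomial_edge_ideal n E) k"
    using symbolic_power_reduce[OF f] by blast
qed

end

theorem corollary3p4:
  fixes n k :: nat
    and E :: "nat set set"
  assumes "simple_graph n E"
    and "closed_graph n E"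
    and "k \<ge> 1"
  shows "symbolic_power (polynomial_ring n) (binomial_edge_ideal n E :: ('k::field) mpoly set) k
    = ideal_power (polynomial_ring n) (binomial_edge_ideal n E) k"
proof -
  obtain l where l: "bij_betw l {1..n} {1..n}"
    "\<forall>u\<in>{1..n}. \<forall>v\<in>{1..n}. \<forall>w\<in>{1..n}. {u, w} \<in> E \<and> l u < l v \<and> l v < l w \<longrightarrow> {u, v} \<in> E \<and> {v, w} \<in> E"
    using assms(2) unfolding closed_graph_def by blast
  interpret closed_labeling n E l
  proof
    show "l i \<le> n" if "i \<in> {1..n}" for i
      using bij_betwE[OF l(1)] that by force
    show "{u, v} \<in> E \<and> {v, w} \<in> E" if "{u, w} \<in> E" "v \<in> {1..n}" "l u < l v" "l v < l w" for u v w
      using assms(1) l(2) that unfolding simple_graph_def by blast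
  qed (use assms(1) l(1) in \<open>auto simp: bij_betw_def\<close>)
  show ?thesis by (rule symbolic_power_eq)
qed

end
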